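(* Let $\Bbbk$ be a field and let $G$ be a group. There is a $\Bbbk$-coalgebra $C$ such that $\operatorname{Aut}(C)\cong K\rtimes G$, where $K$ is a direct product of semidirect products of the form $\Bbbk\rtimes\Bbbk^\times$. Furthermore, $G$ is the image of the restriction of the automorphisms of $C$ to $\operatorname{Sym}\big(G(C)\big)$; that is, the restriction map $\operatorname{Aut}(C)\to\operatorname{Sym}\big(G(C)\big)$, $f\mapsto f|_{G(C)}$, maps the factor $G$ of $\operatorname{Aut}(C)\cong K\rtimes G$ isomorphically onto its image.
   Context: Groups are arbitrary (possibly infinite). Coalgebras are coassociative and counital. For a coalgebra $(C,\Delta,\varepsilon)$, $G(C)=\{c\in C\mid \Delta(c)=c\otimes c,\ \varepsilon(c)=1\}$ is the set of grouplike elements and $\operatorname{Aut}(C)$ is the group of coalgebra automorphisms; every coalgebra automorphism permutes $G(C)$. $\operatorname{Sym}(X)$ is the group of all permutations of a set $X$. In $\Bbbk\rtimes\Bbbk^\times$, the multiplicative group $\Bbbk^\times$ acts on the additive group $\Bbbk$ by multiplication. Direct products are full (unrestricted) direct products over an arbitrary index set. *)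

theory Defs
  imports "HOL-Algebra.AbelCoset" "HOL-Algebra.Bij" "HOL-Algebra.Module" "HOL-Algebra.Product_Groups"
begin

section \<open>Semidirect products of groups\<close>

definition semidirect_product ::
  "('a, 'm) monoid_scheme \<Rightarrow> ('b, 'n) monoid_scheme \<Rightarrow> ('b \<Rightarrow> 'a \<Rightarrow> 'a) \<Rightarrow> ('a \<times> 'b) monoid"
  where "semidirect_product N H \<phi> =
    \<lparr>carrier = carrier N \<times> carrier H,
     monoid.mult = (\<lambda>(n, h) (n', h'). (n \<otimes>\<^bsub>N\<^esub> \<phi> h n', h \<otimes>\<^bsub>H\<^esub> h')),
     one = (\<one>\<^bsub>N\<^esub>, \<one>\<^bsub>H\<^esub>)\<rparr>"

definition affine_group :: "('a, 'm) ring_scheme \<Rightarrow> ('a \<times> 'a) monoid"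
  where "affine_group R =
    semidirect_product (add_monoid R) (units_of R)
      (\<lambda>u\<in>Units R. \<lambda>x\<in>carrier R. u \<otimes>\<^bsub>R\<^esub> x)"

section \<open>Modules and tensor products\<close>

text \<open>
  Module records carry the ring fields \<open>mult\<close> and \<open>one\<close>, which the locale
  \<open>module\<close> ignores.
\<close>

definition linear_maps ::
  "('a, 'm) ring_scheme \<Rightarrow> ('a, 'b, 'n) module_scheme \<Rightarrow> ('a, 'c, 'p) module_scheme \<Rightarrow> ('b \<Rightarrow> 'c) set"
  where "linear_maps R M N = {f \<in> carrier M \<rightarrow> carrier N.
    (\<forall>x\<in>carrier M. \<forall>y\<in>carrier M. f (x \<oplus>\<^bsub>M\<^esub> y) = f x \<oplus>\<^bsub>N\<^esub> f y) \<and>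
    (\<forall>a\<in>carrier R. \<forall>x\<in>carrier M. f (a \<odot>\<^bsub>M\<^esub> x) = a \<odot>\<^bsub>N\<^esub> f x)}"

definition ring_as_module :: "('a, 'm) ring_scheme \<Rightarrow> ('a, 'a) module"
  where "ring_as_module R =
    \<lparr>carrier = carrier R, monoid.mult = monoid.mult R, one = monoid.one R,
     ring.zero = ring.zero R, add = ring.add R, smult = monoid.mult R\<rparr>"

text \<open>
  The free module on \<open>X\<close>: finitely supported functions on \<open>X\<close>, extended by zero.
\<close>

definition free_module :: "('a, 'm) ring_scheme \<Rightarrow> 'x set \<Rightarrow> ('a, 'x \<Rightarrow> 'a) module"
  where "free_module R X =
    \<lparr>carrier = {f. (\<forall>x. f x \<in> carrier R) \<and> {x. f x \<noteq> \<zero>\<^bsub>R\<^esub>} \<subseteq> X \<and> finite {x. f x \<noteq> \<zero>\<^bsub>R\<^esub>}},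
     monoid.mult = undefined, one = undefined,
     ring.zero = (\<lambda>x. \<zero>\<^bsub>R\<^esub>),
     add = (\<lambda>f g x. f x \<oplus>\<^bsub>R\<^esub> g x),
     smult = (\<lambda>a f x. a \<otimes>\<^bsub>R\<^esub> f x)\<rparr>"

definition free_generator :: "('a, 'm) ring_scheme \<Rightarrow> 'x \<Rightarrow> 'x \<Rightarrow> 'a"
  where "free_generator R x = (\<lambda>y. if y = x then \<one>\<^bsub>R\<^esub> else \<zero>\<^bsub>R\<^esub>)"

definition free_extension ::
  "('a, 'm) ring_scheme \<Rightarrow> ('a, 'b, 'n) module_scheme \<Rightarrow> ('x \<Rightarrow> 'b) \<Rightarrow> ('x \<Rightarrow> 'a) \<Rightarrow> 'b"
  where "free_extension R P \<beta> f = (\<Oplus>\<^bsub>P\<^esub>x\<in>{x. f x \<noteq> \<zero>\<^bsub>R\<^esub>}. f x \<odot>\<^bsub>P\<^esub> \<beta> x)"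

definition generated_submodule ::
  "('a, 'm) ring_scheme \<Rightarrow> ('a, 'b, 'n) module_scheme \<Rightarrow> 'b set \<Rightarrow> 'b set"
  where "generated_submodule R M S = \<Inter>{H. submodule H R M \<and> S \<subseteq> H}"

text \<open>
  In the quotient, \<open>a \<odot> (H + x) = H + a \<odot> x\<close>; the summand \<open>H\<close> is needed since
  scaling a coset elementwise by a non-unit does not give a coset.
\<close>

definition quotient_module ::
  "('a, 'm) ring_scheme \<Rightarrow> ('a, 'b, 'n) module_scheme \<Rightarrow> 'b set \<Rightarrow> ('a, 'b set) module"
  where "quotient_module R M H =
    \<lparr>carrier = a_rcosets\<^bsub>M\<^esub> H,
     monoid.mult = undefined, one = undefined,
     ring.zero = H,
     add = (\<lambda>X Y. X <+>\<^bsub>M\<^esub> Y),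
     smult = (\<lambda>a X. \<Union>x\<in>X. H +>\<^bsub>M\<^esub> (a \<odot>\<^bsub>M\<^esub> x))\<rparr>"

definition bilinear_relations ::
  "('a, 'm) ring_scheme \<Rightarrow> ('a, 'b, 'n) module_scheme \<Rightarrow> ('a, 'c, 'p) module_scheme \<Rightarrow> ('b \<times> 'c \<Rightarrow> 'a) set"
  where "bilinear_relations R M N =
    (let F = free_module R (carrier M \<times> carrier N); \<delta> = (\<lambda>m n. free_generator R (m, n)) in
      {\<delta> (m \<oplus>\<^bsub>M\<^esub> m') n \<ominus>\<^bsub>F\<^esub> (\<delta> m n \<oplus>\<^bsub>F\<^esub> \<delta> m' n) | m m' n.
        m \<in> carrier M \<and> m' \<in> carrier M \<and> n \<in> carrier N} \<union>
      {\<delta> m (n \<oplus>\<^bsub>N\<^esub> n') \<ominus>\<^bsub>F\<^esub> (\<delta> m n \<oplus>\<^bsub>F\<^esub> \<delta> m n') | m n n'.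
        m \<in> carrier M \<and> n \<in> carrier N \<and> n' \<in> carrier N} \<union>
      {\<delta> (a \<odot>\<^bsub>M\<^esub> m) n \<ominus>\<^bsub>F\<^esub> a \<odot>\<^bsub>F\<^esub> \<delta> m n | a m n.
        a \<in> carrier R \<and> m \<in> carrier M \<and> n \<in> carrier N} \<union>
      {\<delta> m (a \<odot>\<^bsub>N\<^esub> n) \<ominus>\<^bsub>F\<^esub> a \<odot>\<^bsub>F\<^esub> \<delta> m n | a m n.
        a \<in> carrier R \<and> m \<in> carrier M \<and> n \<in> carrier N})"

definition tensor_relations ::
  "('a, 'm) ring_scheme \<Rightarrow> ('a, 'b, 'n) module_scheme \<Rightarrow> ('a, 'c, 'p) module_scheme \<Rightarrow> ('b \<times> 'c \<Rightarrow> 'a) set"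
  where "tensor_relations R M N =
    generated_submodule R (free_module R (carrier M \<times> carrier N)) (bilinear_relations R M N)"

type_synonym ('a, 'b, 'c) tensor = "('b \<times> 'c \<Rightarrow> 'a) set"

definition tensor_module ::
  "('a, 'm) ring_scheme \<Rightarrow> ('a, 'b, 'n) module_scheme \<Rightarrow> ('a, 'c, 'p) module_scheme
    \<Rightarrow> ('a, ('a, 'b, 'c) tensor) module"
  where "tensor_module R M N =
    quotient_module R (free_module R (carrier M \<times> carrier N)) (tensor_relations R M N)"

definition pure_tensor ::
  "('a, 'm) ring_scheme \<Rightarrow> ('a, 'b, 'n) module_scheme \<Rightarrow> ('a, 'c, 'p) module_scheme
    \<Rightarrow> 'b \<Rightarrow> 'c \<Rightarrow> ('a, 'b, 'c) tensor"
  where "pure_tensor R M N m n =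
    tensor_relations R M N +>\<^bsub>free_module R (carrier M \<times> carrier N)\<^esub> free_generator R (m, n)"

text \<open>
  The linear map into \<open>P\<close> induced by a bilinear map \<open>\<beta>\<close>: all representatives of a
  tensor have the same image in \<open>P\<close> (see \<open>tensor_lift_coset\<close> below).
\<close>

definition tensor_lift ::
  "('a, 'm) ring_scheme \<Rightarrow> ('a, 'd, 'q) module_scheme \<Rightarrow> ('b \<Rightarrow> 'c \<Rightarrow> 'd) \<Rightarrow> ('a, 'b, 'c) tensor \<Rightarrow> 'd"
  where "tensor_lift R P \<beta> t = the_elem (free_extension R P (\<lambda>(m, n). \<beta> m n) ` t)"

definition tensor_map ::
  "('a, 'm) ring_scheme \<Rightarrow> ('a, 'd, 'q) module_scheme \<Rightarrow> ('a, 'e, 'r) module_scheme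
    \<Rightarrow> ('b \<Rightarrow> 'd) \<Rightarrow> ('c \<Rightarrow> 'e) \<Rightarrow> ('a, 'b, 'c) tensor \<Rightarrow> ('a, 'd, 'e) tensor"
  where "tensor_map R M' N' f g =
    tensor_lift R (tensor_module R M' N') (\<lambda>m n. pure_tensor R M' N' (f m) (g n))"

definition tensor_assoc ::
  "('a, 'm) ring_scheme \<Rightarrow> ('a, 'b, 'n) module_scheme \<Rightarrow> ('a, 'c, 'p) module_scheme
    \<Rightarrow> ('a, 'd, 'q) module_scheme
    \<Rightarrow> ('a, ('a, 'b, 'c) tensor, 'd) tensor \<Rightarrow> ('a, 'b, ('a, 'c, 'd) tensor) tensor"
  where "tensor_assoc R M N P =
    tensor_lift R (tensor_module R M (tensor_module R N P))
      (\<lambda>t p. tensor_lift R (tensor_module R M (tensor_module R N P))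
        (\<lambda>m n. pure_tensor R M (tensor_module R N P) m (pure_tensor R N P n p)) t)"

section \<open>Coalgebras\<close>

record ('a, 'b) coalgebra = "('a, 'b) module" +
  comult :: "'b \<Rightarrow> ('a, 'b, 'b) tensor"
  counit :: "'b \<Rightarrow> 'a"

locale coalgebra = module R C for R (structure) and C :: "('a, 'b, 'n) coalgebra_scheme" +
  assumes comult_linear: "comult C \<in> linear_maps R C (tensor_module R C C)"
    and counit_linear: "counit C \<in> linear_maps R C (ring_as_module R)"
    and coassoc: "c \<in> carrier C \<Longrightarrow>
      tensor_assoc R C C C (tensor_map R (tensor_module R C C) C (comult C) (\<lambda>x. x) (comult C c))
      = tensor_map R C (tensor_module R C C) (\<lambda>x. x) (comult C) (comult C c)"
    and counit_left: "c \<in> carrier C \<Longrightarrow>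
      tensor_map R (ring_as_module R) C (counit C) (\<lambda>x. x) (comult C c)
      = pure_tensor R (ring_as_module R) C \<one> c"
    and counit_right: "c \<in> carrier C \<Longrightarrow>
      tensor_map R C (ring_as_module R) (\<lambda>x. x) (counit C) (comult C c)
      = pure_tensor R C (ring_as_module R) c \<one>"

definition grouplikes :: "('a, 'm) ring_scheme \<Rightarrow> ('a, 'b, 'n) coalgebra_scheme \<Rightarrow> 'b set"
  where "grouplikes R C =
    {c \<in> carrier C. comult C c = pure_tensor R C C c c \<and> counit C c = \<one>\<^bsub>R\<^esub>}"

definition coalgebra_autos ::
  "('a, 'm) ring_scheme \<Rightarrow> ('a, 'b, 'n) coalgebra_scheme \<Rightarrow> ('b \<Rightarrow> 'b) set"
  where "coalgebra_autos R C = {f \<in> linear_maps R C C \<inter> Bij (carrier C). \<forall>c\<in>carrier C.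
    comult C (f c) = tensor_map R C C f f (comult C c) \<and> counit C (f c) = counit C c}"

definition coalgebra_AutoGroup ::
  "('a, 'm) ring_scheme \<Rightarrow> ('a, 'b, 'n) coalgebra_scheme \<Rightarrow> ('b \<Rightarrow> 'b) monoid"
  where "coalgebra_AutoGroup R C = BijGroup (carrier C) \<lparr>carrier := coalgebra_autos R C\<rparr>"

definition grouplike_restriction ::
  "('a, 'm) ring_scheme \<Rightarrow> ('a, 'b, 'n) coalgebra_scheme \<Rightarrow> ('b \<Rightarrow> 'b) \<Rightarrow> 'b \<Rightarrow> 'b"
  where "grouplike_restriction R C f = restrict f (grouplikes R C)"

section \<open>Well-definedness\<close>

lemma AutoGroup_hom_action:
  assumes "\<phi> \<in> hom H (AutoGroup N)" "h \<in> carrier H"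
  shows "n \<in> carrier N \<Longrightarrow> \<phi> h n \<in> carrier N"
    and "n \<in> carrier N \<Longrightarrow> n' \<in> carrier N \<Longrightarrow> \<phi> h (n \<otimes>\<^bsub>N\<^esub> n') = \<phi> h n \<otimes>\<^bsub>N\<^esub> \<phi> h n'"
    and "h' \<in> carrier H \<Longrightarrow> n \<in> carrier N \<Longrightarrow> \<phi> (h \<otimes>\<^bsub>H\<^esub> h') n = \<phi> h (\<phi> h' n)"
proof -
  have auto: "\<phi> h \<in> auto N" if "h \<in> carrier H" for h
    using assms(1) that by (auto simp: hom_def AutoGroup_def BijGroup_def)
  show "n \<in> carrier N \<Longrightarrow> \<phi> h n \<in> carrier N"
    and "n \<in> carrier N \<Longrightarrow> n' \<in> carrier N \<Longrightarrow> \<phi> h (n \<otimes>\<^bsub>N\<^esub> n') = \<phi> h n \<otimes>\<^bsub>N\<^esub> \<phi> h n'"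
    using auto[OF assms(2)] by (auto simp: auto_def hom_def)
  assume "h' \<in> carrier H" "n \<in> carrier N"
  with assms auto[OF assms(2)] auto[of h'] show "\<phi> (h \<otimes>\<^bsub>H\<^esub> h') n = \<phi> h (\<phi> h' n)"
    by (auto simp: hom_def AutoGroup_def BijGroup_def auto_def compose_def)
qed

lemma group_semidirect_product:
  assumes "group N" "group H" "\<phi> \<in> hom H (AutoGroup N)"
  shows "group (semidirect_product N H \<phi>)"
proof -
  interpret N: group N by fact
  interpret H: group H by fact
  note act = AutoGroup_hom_action[OF assms(3)]
  have one: "\<phi> \<one>\<^bsub>H\<^esub> n = n" if "n \<in> carrier N" for n
    using hom_one[OF assms(3) assms(2) N.AutoGroup] that by (simp add: AutoGroup_def BijGroup_def)
  have one': "\<phi> h \<one>\<^bsub>N\<^esub> = \<one>\<^bsub>N\<^esub>" if "h \<in> carrier H" for h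
    using act(1,2)[OF that, of "\<one>\<^bsub>N\<^esub>"] by (metis N.l_cancel_one' N.l_one N.one_closed)
  show ?thesis
  proof (rule groupI)
    fix x assume "x \<in> carrier (semidirect_product N H \<phi>)"
    then obtain n h where x: "x = (n, h)" "n \<in> carrier N" "h \<in> carrier H"
      by (auto simp: semidirect_product_def)
    let ?y = "(\<phi> (inv\<^bsub>H\<^esub> h) (inv\<^bsub>N\<^esub> n), inv\<^bsub>H\<^esub> h)"
    have "\<phi> (inv\<^bsub>H\<^esub> h) (inv\<^bsub>N\<^esub> n) \<otimes>\<^bsub>N\<^esub> \<phi> (inv\<^bsub>H\<^esub> h) n = \<one>\<^bsub>N\<^esub>"
      using x one' by (simp flip: act(2))
    then show "\<exists>y\<in>carrier (semidirect_product N H \<phi>).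
        y \<otimes>\<^bsub>semidirect_product N H \<phi>\<^esub> x = \<one>\<^bsub>semidirect_product N H \<phi>\<^esub>"
      using x act(1) by (intro bexI[of _ ?y]) (auto simp: semidirect_product_def)
  qed (auto simp: semidirect_product_def act one N.m_assoc H.m_assoc)
qed

lemma group_affine_group:
  assumes "cring R"
  shows "group (affine_group R)"
proof -
  interpret cring R by fact
  have bij: "(\<lambda>x\<in>carrier R. u \<otimes>\<^bsub>R\<^esub> x) \<in> Bij (carrier R)" if u: "u \<in> Units R" for u
  proof -
    have "bij_betw (\<lambda>x. u \<otimes>\<^bsub>R\<^esub> x) (carrier R) (carrier R)"
      using u by (intro bij_betw_byWitness[where f' = "\<lambda>x. inv\<^bsub>R\<^esub> u \<otimes>\<^bsub>R\<^esub> x"])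
        (auto simp: m_assoc[symmetric] Units_closed)
    then show ?thesis by (simp add: Bij_def cong: bij_betw_cong)
  qed
  have "(\<lambda>u\<in>Units R. \<lambda>x\<in>carrier R. u \<otimes>\<^bsub>R\<^esub> x) \<in> hom (units_of R) (AutoGroup (add_monoid R))"
    by (rule homI)
      (auto simp: bij AutoGroup_def auto_def BijGroup_def hom_def units_of_def r_distr m_assoc
        compose_def Units_closed intro!: restrict_ext)
  then show ?thesis
    unfolding affine_group_def
    by (intro group_semidirect_product units_group add.is_group)
qed

lemma linear_mapsI:
  assumes "\<And>x. x \<in> carrier M \<Longrightarrow> f x \<in> carrier N"
    and "\<And>x y. x \<in> carrier M \<Longrightarrow> y \<in> carrier M \<Longrightarrow> f (x \<oplus>\<^bsub>M\<^esub> y) = f x \<oplus>\<^bsub>N\<^esub> f y"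
    and "\<And>a x. a \<in> carrier R \<Longrightarrow> x \<in> carrier M \<Longrightarrow> f (a \<odot>\<^bsub>M\<^esub> x) = a \<odot>\<^bsub>N\<^esub> f x"
  shows "f \<in> linear_maps R M N"
  using assms by (simp add: linear_maps_def)

lemma linear_mapsD:
  assumes "f \<in> linear_maps R M N"
  shows "x \<in> carrier M \<Longrightarrow> f x \<in> carrier N"
    and "x \<in> carrier M \<Longrightarrow> y \<in> carrier M \<Longrightarrow> f (x \<oplus>\<^bsub>M\<^esub> y) = f x \<oplus>\<^bsub>N\<^esub> f y"
    and "a \<in> carrier R \<Longrightarrow> x \<in> carrier M \<Longrightarrow> f (a \<odot>\<^bsub>M\<^esub> x) = a \<odot>\<^bsub>N\<^esub> f x"
  using assms by (auto simp: linear_maps_def)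

lemma linear_maps_zero:
  assumes "module R M" "module R N" "f \<in> linear_maps R M N"
  shows "f \<zero>\<^bsub>M\<^esub> = \<zero>\<^bsub>N\<^esub>"
proof -
  interpret M: module R M by fact
  interpret N: module R N by fact
  have "f \<zero>\<^bsub>M\<^esub> = f (\<zero>\<^bsub>R\<^esub> \<odot>\<^bsub>M\<^esub> \<zero>\<^bsub>M\<^esub>)" by simp
  also have "\<dots> = \<zero>\<^bsub>R\<^esub> \<odot>\<^bsub>N\<^esub> f \<zero>\<^bsub>M\<^esub>"
    by (rule linear_mapsD(3)[OF assms(3)]) auto
  also have "\<dots> = \<zero>\<^bsub>N\<^esub>" using linear_mapsD(1)[OF assms(3)] by simp
  finally show ?thesis .
qed

lemma linear_maps_uminus:
  assumes "module R M" "module R N" "f \<in> linear_maps R M N" "x \<in> carrier M"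
  shows "f (\<ominus>\<^bsub>M\<^esub> x) = \<ominus>\<^bsub>N\<^esub> f x"
proof -
  interpret M: module R M by fact
  interpret N: module R N by fact
  have "f x \<in> carrier N" "f (\<ominus>\<^bsub>M\<^esub> x) \<in> carrier N"
    using linear_mapsD(1)[OF assms(3)] assms(4) by auto
  moreover have "f (\<ominus>\<^bsub>M\<^esub> x) \<oplus>\<^bsub>N\<^esub> f x = \<zero>\<^bsub>N\<^esub>"
    using linear_mapsD(2)[OF assms(3), of "\<ominus>\<^bsub>M\<^esub> x" x] assms(4) linear_maps_zero[OF assms(1-3)]
    by (simp add: M.M.l_neg)
  ultimately show ?thesis by (metis N.M.minus_equality)
qed

lemma linear_maps_minus:
  assumes "module R M" "module R N" "f \<in> linear_maps R M N" "x \<in> carrier M" "y \<in> carrier M"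
  shows "f (x \<ominus>\<^bsub>M\<^esub> y) = f x \<ominus>\<^bsub>N\<^esub> f y"
proof -
  interpret M: module R M by fact
  show ?thesis
    using linear_mapsD(2)[OF assms(3), of x "\<ominus>\<^bsub>M\<^esub> y"] linear_maps_uminus[OF assms(1-3,5)] assms(4,5)
    by (simp add: a_minus_def)
qed

lemma kernel_submodule:
  assumes "module R M" "module R N" "f \<in> linear_maps R M N"
  shows "submodule {x \<in> carrier M. f x = \<zero>\<^bsub>N\<^esub>} R M"
proof -
  interpret M: module R M by fact
  interpret N: module R N by fact
  show ?thesis
    by (rule M.submoduleI)
      (auto simp: linear_maps_zero[OF assms] linear_maps_uminus[OF assms] linear_mapsD[OF assms(3)])
qed

lemma linear_maps_finsum:
  assumes "module R M" "module R N" "f \<in> linear_maps R M N" "finite A" "g \<in> A \<rightarrow> carrier M"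
  shows "f (\<Oplus>\<^bsub>M\<^esub>x\<in>A. g x) = (\<Oplus>\<^bsub>N\<^esub>x\<in>A. f (g x))"
  using assms(4,5)
proof (induction A)
  case empty
  interpret M: module R M by fact
  interpret N: module R N by fact
  show ?case using linear_maps_zero[OF assms(1-3)] by simp
next
  case (insert a A)
  interpret M: module R M by fact
  interpret N: module R N by fact
  have "(\<lambda>x. f (g x)) \<in> A \<rightarrow> carrier N" "f (g a) \<in> carrier N"
    using insert.prems linear_mapsD(1)[OF assms(3)] by auto
  then show ?case
    using insert linear_mapsD(2)[OF assms(3), of "g a" "\<Oplus>\<^bsub>M\<^esub>x\<in>A. g x"] by simp
qed

lemma ring_as_module: "cring R \<Longrightarrow> module R (ring_as_module R)"
proof -
  assume "cring R"
  then interpret cring R .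
  show ?thesis
  proof (rule moduleI)
    show "abelian_group (ring_as_module R)"
    proof (rule abelian_groupI)
      fix x assume "x \<in> carrier (ring_as_module R)"
      then show "\<exists>y\<in>carrier (ring_as_module R). y \<oplus>\<^bsub>ring_as_module R\<^esub> x = \<zero>\<^bsub>ring_as_module R\<^esub>"
        by (intro bexI[of _ "\<ominus>\<^bsub>R\<^esub> x"]) (auto simp: ring_as_module_def l_neg)
    qed (auto simp: ring_as_module_def a_assoc intro: a_comm)
  qed (auto simp: ring_as_module_def m_assoc l_distr r_distr is_cring)
qed

context cring
begin

lemma module_free_module: "module R (free_module R X)"
proof (rule moduleI)
  let ?F = "free_module R X"
  have fin: "finite {x. h x \<noteq> \<zero>}" "{x. h x \<noteq> \<zero>} \<subseteq> X"
    if "f \<in> carrier ?F" "g \<in> carrier ?F" "\<And>x. f x = \<zero> \<Longrightarrow> g x = \<zero> \<Longrightarrow> h x = \<zero>" for f g h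
  proof -
    have "{x. h x \<noteq> \<zero>} \<subseteq> {x. f x \<noteq> \<zero>} \<union> {x. g x \<noteq> \<zero>}" using that(3) by auto
    moreover have "finite ({x. f x \<noteq> \<zero>} \<union> {x. g x \<noteq> \<zero>})" "{x. f x \<noteq> \<zero>} \<union> {x. g x \<noteq> \<zero>} \<subseteq> X"
      using that(1,2) by (auto simp: free_module_def)
    ultimately show "finite {x. h x \<noteq> \<zero>}" "{x. h x \<noteq> \<zero>} \<subseteq> X"
      by (auto intro: finite_subset)
  qed
  show "cring R" by (rule is_cring)
  show "abelian_group ?F"
  proof (rule abelian_groupI)
    fix f assume f: "f \<in> carrier ?F"
    have "(\<lambda>x. \<ominus> f x) \<in> carrier ?F"
      using fin[OF f f, of "\<lambda>x. \<ominus> f x"] f by (auto simp: free_module_def)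
    then show "\<exists>g\<in>carrier ?F. g \<oplus>\<^bsub>?F\<^esub> f = \<zero>\<^bsub>?F\<^esub>"
      using f by (intro bexI[of _ "\<lambda>x. \<ominus> f x"]) (auto simp: free_module_def l_neg)
  next
    fix f g assume fg: "f \<in> carrier ?F" "g \<in> carrier ?F"
    show "f \<oplus>\<^bsub>?F\<^esub> g \<in> carrier ?F"
      using fin[OF fg, of "\<lambda>x. f x \<oplus> g x"] fg by (auto simp: free_module_def)
  qed (auto simp: free_module_def a_ac)
  fix a f assume a: "a \<in> carrier R" and f: "f \<in> carrier ?F"
  show "a \<odot>\<^bsub>?F\<^esub> f \<in> carrier ?F"
    using fin[OF f f, of "\<lambda>x. a \<otimes> f x"] f a by (auto simp: free_module_def)
qed (auto simp: free_module_def l_distr r_distr m_assoc)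

lemma free_generator_closed: "x \<in> X \<Longrightarrow> free_generator R x \<in> carrier (free_module R X)"
proof -
  assume "x \<in> X"
  moreover have "{y. free_generator R x y \<noteq> \<zero>} \<subseteq> {x}" by (auto simp: free_generator_def)
  ultimately show ?thesis
    by (auto simp: free_module_def free_generator_def)
qed

lemma free_extension_superset:
  assumes "module R P" "\<beta> \<in> X \<rightarrow> carrier P" "f \<in> carrier (free_module R X)"
    and "finite A" "A \<subseteq> X" "{x. f x \<noteq> \<zero>} \<subseteq> A"
  shows "free_extension R P \<beta> f = (\<Oplus>\<^bsub>P\<^esub>x\<in>A. f x \<odot>\<^bsub>P\<^esub> \<beta> x)"
proof -
  interpret P: module R P by fact
  show ?thesis unfolding free_extension_def
    using assms(2-6)
    by (intro P.add.finprod_mono_neutral_cong_left) (auto simp: free_module_def Pi_iff subset_iff)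
qed

lemma free_extension_linear:
  assumes "module R P" "\<beta> \<in> X \<rightarrow> carrier P"
  shows "free_extension R P \<beta> \<in> linear_maps R (free_module R X) P"
proof (rule linear_mapsI)
  interpret P: module R P by fact
  interpret F: module R "free_module R X" by (rule module_free_module)
  let ?F = "free_module R X" and ?S = "\<lambda>f. {x. f x \<noteq> \<zero>}"
  have S: "finite (?S f)" "?S f \<subseteq> X" "\<And>x. f x \<in> carrier R" if "f \<in> carrier ?F" for f
    using that by (auto simp: free_module_def)
  fix f assume f: "f \<in> carrier ?F"
  then show "free_extension R P \<beta> f \<in> carrier P"
    using assms(2) S[OF f] unfolding free_extension_def
    by (intro P.M.finsum_closed) (auto simp: Pi_iff subset_iff)
  { fix g assume g: "g \<in> carrier ?F"
    let ?A = "?S f \<union> ?S g"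
    have A: "finite ?A" "?A \<subseteq> X" using S[OF f] S[OF g] by auto
    have b: "\<beta> x \<in> carrier P" if "x \<in> ?A" for x using that A(2) assms(2) by blast
    have sub: "?S (f \<oplus>\<^bsub>?F\<^esub> g) \<subseteq> ?A" by (auto simp: free_module_def)
    have "free_extension R P \<beta> (f \<oplus>\<^bsub>?F\<^esub> g) = (\<Oplus>\<^bsub>P\<^esub>x\<in>?A. (f \<oplus>\<^bsub>?F\<^esub> g) x \<odot>\<^bsub>P\<^esub> \<beta> x)"
      by (rule free_extension_superset[OF assms F.M.add.m_closed[OF f g] A sub, simplified])
    also have "\<dots> = (\<Oplus>\<^bsub>P\<^esub>x\<in>?A. f x \<odot>\<^bsub>P\<^esub> \<beta> x \<oplus>\<^bsub>P\<^esub> g x \<odot>\<^bsub>P\<^esub> \<beta> x)"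
      using S(3)[OF f] S(3)[OF g] b
      by (intro P.M.finsum_cong') (auto simp: free_module_def P.smult_l_distr)
    also have "\<dots> = (\<Oplus>\<^bsub>P\<^esub>x\<in>?A. f x \<odot>\<^bsub>P\<^esub> \<beta> x) \<oplus>\<^bsub>P\<^esub> (\<Oplus>\<^bsub>P\<^esub>x\<in>?A. g x \<odot>\<^bsub>P\<^esub> \<beta> x)"
      using S(3)[OF f] S(3)[OF g] b by (intro P.M.finsum_addf) auto
    also have "\<dots> = free_extension R P \<beta> f \<oplus>\<^bsub>P\<^esub> free_extension R P \<beta> g"
      using free_extension_superset[OF assms f A] free_extension_superset[OF assms g A] by simp
    finally show "free_extension R P \<beta> (f \<oplus>\<^bsub>?F\<^esub> g) = free_extension R P \<beta> f \<oplus>\<^bsub>P\<^esub> free_extension R P \<beta> g" .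
  }
  fix a assume a: "a \<in> carrier R"
  have sub: "?S (a \<odot>\<^bsub>?F\<^esub> f) \<subseteq> ?S f" using a by (auto simp: free_module_def)
  have b: "\<beta> x \<in> carrier P" if "x \<in> ?S f" for x using that S(2)[OF f] assms(2) by blast
  have "free_extension R P \<beta> (a \<odot>\<^bsub>?F\<^esub> f) = (\<Oplus>\<^bsub>P\<^esub>x\<in>?S f. (a \<odot>\<^bsub>?F\<^esub> f) x \<odot>\<^bsub>P\<^esub> \<beta> x)"
    using free_extension_superset[OF assms F.smult_closed[OF a f] S(1,2)[OF f] sub] .
  also have "\<dots> = (\<Oplus>\<^bsub>P\<^esub>x\<in>?S f. a \<odot>\<^bsub>P\<^esub> (f x \<odot>\<^bsub>P\<^esub> \<beta> x))"
    using a S(3)[OF f] b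
    by (intro P.M.finsum_cong') (auto simp: free_module_def P.smult_assoc1)
  also have "\<dots> = a \<odot>\<^bsub>P\<^esub> free_extension R P \<beta> f"
    unfolding free_extension_def
    using a S(1,3)[OF f] b by (intro P.finsum_smult_ldistr[symmetric]) auto
  finally show "free_extension R P \<beta> (a \<odot>\<^bsub>?F\<^esub> f) = a \<odot>\<^bsub>P\<^esub> free_extension R P \<beta> f" .
qed

lemma free_extension_generator:
  assumes "module R P" "\<beta> \<in> X \<rightarrow> carrier P" "x \<in> X"
  shows "free_extension R P \<beta> (free_generator R x) = \<beta> x"
proof -
  interpret P: module R P by fact
  have "free_extension R P \<beta> (free_generator R x)
      = (\<Oplus>\<^bsub>P\<^esub>y\<in>{x}. free_generator R x y \<odot>\<^bsub>P\<^esub> \<beta> y)"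
    using assms by (intro free_extension_superset free_generator_closed) (auto simp: free_generator_def)
  also have "\<dots> = \<one> \<odot>\<^bsub>P\<^esub> \<beta> x"
    using assms by (subst P.M.finsum_insert) (auto simp: free_generator_def Pi_iff)
  also have "\<dots> = \<beta> x" using assms(2,3) by (intro P.smult_one) auto
  finally show ?thesis .
qed

lemma free_module_expansion:
  assumes "f \<in> carrier (free_module R X)"
  shows "free_extension R (free_module R X) (free_generator R) f = f"
proof -
  let ?F = "free_module R X"
  interpret F: module R ?F by (rule module_free_module)
  have eval: "(\<lambda>g. g y) \<in> linear_maps R ?F (ring_as_module R)" for y
    by (rule linear_mapsI) (auto simp: free_module_def ring_as_module_def)
  have S: "finite {x. f x \<noteq> \<zero>}" "{x. f x \<noteq> \<zero>} \<subseteq> X" "\<And>x. f x \<in> carrier R"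
    using assms by (auto simp: free_module_def)
  interpret K: module R "ring_as_module R" by (rule ring_as_module) (rule is_cring)
  have cl: "(\<lambda>x. f x \<odot>\<^bsub>?F\<^esub> free_generator R x) \<in> {x. f x \<noteq> \<zero>} \<rightarrow> carrier ?F"
    using S by (auto intro!: F.smult_closed free_generator_closed)
  show ?thesis
  proof
    fix y
    have "free_extension R ?F (free_generator R) f y
      = (\<Oplus>\<^bsub>ring_as_module R\<^esub>x\<in>{x. f x \<noteq> \<zero>}. (f x \<odot>\<^bsub>?F\<^esub> free_generator R x) y)"
      unfolding free_extension_def
      by (rule linear_maps_finsum[OF module_free_module K.module_axioms eval S(1) cl])
    also have "\<dots> = (\<Oplus>\<^bsub>ring_as_module R\<^esub>x\<in>{x. f x \<noteq> \<zero>}. if y = x then f x else \<zero>\<^bsub>ring_as_module R\<^esub>)"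
      using S(3) by (intro K.M.finsum_cong') (auto simp: free_module_def free_generator_def ring_as_module_def)
    also have "\<dots> = f y"
    proof (cases "f y = \<zero>")
      case True
      then have "(\<Oplus>\<^bsub>ring_as_module R\<^esub>x\<in>{x. f x \<noteq> \<zero>}. if y = x then f x else \<zero>\<^bsub>ring_as_module R\<^esub>)
         = (\<Oplus>\<^bsub>ring_as_module R\<^esub>x\<in>{x. f x \<noteq> \<zero>}. \<zero>\<^bsub>ring_as_module R\<^esub>)"
        by (intro K.M.finsum_cong') auto
      also have "\<dots> = \<zero>\<^bsub>ring_as_module R\<^esub>" by simp
      finally show ?thesis using True by (simp add: ring_as_module_def)
    next
      case False
      then show ?thesis using S
        by (intro K.M.add.finprod_singleton[of y _ f, simplified]) (auto simp: ring_as_module_def)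
    qed
    finally show "free_extension R ?F (free_generator R) f y = f y" .
  qed
qed

lemma generated_submodule:
  assumes "module R M" "S \<subseteq> carrier M"
  shows "submodule (generated_submodule R M S) R M" and "S \<subseteq> generated_submodule R M S"
    and "\<And>H. submodule H R M \<Longrightarrow> S \<subseteq> H \<Longrightarrow> generated_submodule R M S \<subseteq> H"
proof -
  interpret M: module R M by fact
  note E = M.submoduleE
  have top: "submodule (carrier M) R M" by (rule M.carrier_is_submodule)
  have zero: "\<zero>\<^bsub>M\<^esub> \<in> H" if "submodule H R M" for H
    using subgroup.one_closed[OF submodule.axioms(1)[OF that]] by simp
  show "submodule (generated_submodule R M S) R M"
  proof (rule M.submoduleI)
    show "generated_submodule R M S \<subseteq> carrier M"
      using top assms(2) by (auto simp: generated_submodule_def)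
    show "\<zero>\<^bsub>M\<^esub> \<in> generated_submodule R M S"
      using zero by (auto simp: generated_submodule_def)
    show "\<ominus>\<^bsub>M\<^esub> a \<in> generated_submodule R M S" if "a \<in> generated_submodule R M S" for a
      using that E(3) by (simp add: generated_submodule_def)
    show "a \<oplus>\<^bsub>M\<^esub> b \<in> generated_submodule R M S"
      if "a \<in> generated_submodule R M S" "b \<in> generated_submodule R M S" for a b
      using that E(5) by (simp add: generated_submodule_def)
    show "a \<odot>\<^bsub>M\<^esub> x \<in> generated_submodule R M S"
      if "a \<in> carrier R" "x \<in> generated_submodule R M S" for a x
      using that E(4) by (simp add: generated_submodule_def)
  qed
qed (auto simp: generated_submodule_def)

lemma mem_quotient_carrier:
  assumes "module R M" "submodule H R M"
  shows "X \<in> carrier (quotient_module R M H) \<longleftrightarrow> (\<exists>x\<in>carrier M. X = H +>\<^bsub>M\<^esub> x)"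
  by (auto simp: quotient_module_def A_RCOSETS_def')

lemma quotient_module_ops:
  assumes "module R M" "submodule H R M"
  shows "x \<in> carrier M \<Longrightarrow> y \<in> carrier M \<Longrightarrow>
      (H +>\<^bsub>M\<^esub> x) \<oplus>\<^bsub>quotient_module R M H\<^esub> (H +>\<^bsub>M\<^esub> y) = H +>\<^bsub>M\<^esub> (x \<oplus>\<^bsub>M\<^esub> y)"
    and "a \<in> carrier R \<Longrightarrow> x \<in> carrier M \<Longrightarrow>
      a \<odot>\<^bsub>quotient_module R M H\<^esub> (H +>\<^bsub>M\<^esub> x) = H +>\<^bsub>M\<^esub> (a \<odot>\<^bsub>M\<^esub> x)"
    and "\<zero>\<^bsub>quotient_module R M H\<^esub> = H +>\<^bsub>M\<^esub> \<zero>\<^bsub>M\<^esub>"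
proof -
  interpret M: module R M by fact
  interpret H: submodule H R M by fact
  interpret H: abelian_subgroup H M
    by (rule abelian_subgroupI3) (simp_all add: additive_subgroup_def H.subgroup_axioms M.abelian_group_axioms)
  show "(H +>\<^bsub>M\<^esub> x) \<oplus>\<^bsub>quotient_module R M H\<^esub> (H +>\<^bsub>M\<^esub> y) = H +>\<^bsub>M\<^esub> (x \<oplus>\<^bsub>M\<^esub> y)"
    if "x \<in> carrier M" "y \<in> carrier M"
    using that by (simp add: quotient_module_def H.a_rcos_sum)
  show "\<zero>\<^bsub>quotient_module R M H\<^esub> = H +>\<^bsub>M\<^esub> \<zero>\<^bsub>M\<^esub>"
    using H.a_subset by (simp add: quotient_module_def)
  assume a: "a \<in> carrier R" and x: "x \<in> carrier M"
  have "H +>\<^bsub>M\<^esub> (a \<odot>\<^bsub>M\<^esub> y) = H +>\<^bsub>M\<^esub> (a \<odot>\<^bsub>M\<^esub> x)" if y: "y \<in> H +>\<^bsub>M\<^esub> x" for y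
  proof -
    obtain h where h: "h \<in> H" "y = h \<oplus>\<^bsub>M\<^esub> x" using y by (auto simp: a_r_coset_def')
    have hM: "h \<in> carrier M" using h(1) H.a_subset by blast
    have "a \<odot>\<^bsub>M\<^esub> y \<in> H +>\<^bsub>M\<^esub> (a \<odot>\<^bsub>M\<^esub> x)"
      unfolding h(2) a_r_coset_def' using h(1) a x hM by (auto simp: M.smult_r_distr)
    then show ?thesis
      by (rule H.a_repr_independence'[symmetric]) (use a x in simp)
  qed
  with H.a_rcos_self[OF x] have "(\<Union>y\<in>H +>\<^bsub>M\<^esub> x. H +>\<^bsub>M\<^esub> (a \<odot>\<^bsub>M\<^esub> y)) = H +>\<^bsub>M\<^esub> (a \<odot>\<^bsub>M\<^esub> x)"
    by (intro UN_constant_eq ballI)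
  then show "a \<odot>\<^bsub>quotient_module R M H\<^esub> (H +>\<^bsub>M\<^esub> x) = H +>\<^bsub>M\<^esub> (a \<odot>\<^bsub>M\<^esub> x)"
    by (simp add: quotient_module_def)
qed

lemma module_quotient_module:
  assumes "module R M" "submodule H R M"
  shows "module R (quotient_module R M H)"
proof -
  interpret M: module R M by fact
  note mem = mem_quotient_carrier[OF assms] and ops = quotient_module_ops[OF assms]
  show ?thesis
  proof (rule moduleI)
    show "abelian_group (quotient_module R M H)"
    proof (rule abelian_groupI)
      fix X assume "X \<in> carrier (quotient_module R M H)"
      then obtain x where x: "x \<in> carrier M" "X = H +>\<^bsub>M\<^esub> x" by (auto simp: mem)
      then show "\<exists>Y\<in>carrier (quotient_module R M H).
          Y \<oplus>\<^bsub>quotient_module R M H\<^esub> X = \<zero>\<^bsub>quotient_module R M H\<^esub>"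
        by (intro bexI[of _ "H +>\<^bsub>M\<^esub> \<ominus>\<^bsub>M\<^esub> x"]) (auto simp: mem ops M.M.l_neg)
    qed (auto simp: mem ops M.M.a_ac)
  qed (use is_cring in \<open>auto simp: mem ops M.smult_l_distr M.smult_r_distr M.smult_assoc1\<close>)
qed

lemma bilinear_relations_closed:
  assumes "module R M" "module R N"
  shows "bilinear_relations R M N \<subseteq> carrier (free_module R (carrier M \<times> carrier N))"
proof -
  interpret M: module R M by fact
  interpret N: module R N by fact
  interpret F: module R "free_module R (carrier M \<times> carrier N)" by (rule module_free_module)
  show ?thesis
    by (auto simp: bilinear_relations_def Let_def intro!: F.M.minus_closed F.M.add.m_closed[simplified]
        F.smult_closed free_generator_closed)
qed

lemma tensor_relations_submodule:
  assumes "module R M" "module R N"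
  shows "submodule (tensor_relations R M N) R (free_module R (carrier M \<times> carrier N))"
  unfolding tensor_relations_def
  by (rule generated_submodule(1)[OF module_free_module bilinear_relations_closed[OF assms]])

lemma module_tensor_module:
  assumes "module R M" "module R N"
  shows "module R (tensor_module R M N)"
  unfolding tensor_module_def
  by (rule module_quotient_module[OF module_free_module tensor_relations_submodule[OF assms]])

lemma coset_eqI:
  assumes "module R M" "submodule H R M" "x \<in> carrier M" "y \<in> carrier M" "x \<ominus>\<^bsub>M\<^esub> y \<in> H"
  shows "H +>\<^bsub>M\<^esub> x = H +>\<^bsub>M\<^esub> y"
proof -
  interpret M: module R M by fact
  interpret H: submodule H R M by fact
  interpret H: abelian_subgroup H M
    by (rule abelian_subgroupI3) (simp_all add: additive_subgroup_def H.subgroup_axioms M.abelian_group_axioms)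
  have "x = (x \<ominus>\<^bsub>M\<^esub> y) \<oplus>\<^bsub>M\<^esub> y" using assms(3,4) by (simp add: a_minus_def M.M.a_assoc M.M.l_neg)
  then have "x \<in> H +>\<^bsub>M\<^esub> y" using assms(5) by (auto simp: a_r_coset_def')
  then show ?thesis by (rule H.a_repr_independence'[symmetric]) (rule assms(4))
qed

lemma pure_tensor_bilinear:
  assumes "module R M" "module R N"
  shows "m \<in> carrier M \<Longrightarrow> n \<in> carrier N \<Longrightarrow> pure_tensor R M N m n \<in> carrier (tensor_module R M N)"
    and "m \<in> carrier M \<Longrightarrow> m' \<in> carrier M \<Longrightarrow> n \<in> carrier N \<Longrightarrow>
      pure_tensor R M N (m \<oplus>\<^bsub>M\<^esub> m') n
      = pure_tensor R M N m n \<oplus>\<^bsub>tensor_module R M N\<^esub> pure_tensor R M N m' n"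
    and "m \<in> carrier M \<Longrightarrow> n \<in> carrier N \<Longrightarrow> n' \<in> carrier N \<Longrightarrow>
      pure_tensor R M N m (n \<oplus>\<^bsub>N\<^esub> n')
      = pure_tensor R M N m n \<oplus>\<^bsub>tensor_module R M N\<^esub> pure_tensor R M N m n'"
    and "a \<in> carrier R \<Longrightarrow> m \<in> carrier M \<Longrightarrow> n \<in> carrier N \<Longrightarrow>
      pure_tensor R M N (a \<odot>\<^bsub>M\<^esub> m) n = a \<odot>\<^bsub>tensor_module R M N\<^esub> pure_tensor R M N m n"
    and "a \<in> carrier R \<Longrightarrow> m \<in> carrier M \<Longrightarrow> n \<in> carrier N \<Longrightarrow>
      pure_tensor R M N m (a \<odot>\<^bsub>N\<^esub> n) = a \<odot>\<^bsub>tensor_module R M N\<^esub> pure_tensor R M N m n"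
proof -
  let ?F = "free_module R (carrier M \<times> carrier N)"
  interpret M: module R M by fact
  interpret N: module R N by fact
  interpret F: module R ?F by (rule module_free_module)
  note sub = tensor_relations_submodule[OF assms]
  note ops = quotient_module_ops[OF module_free_module sub, folded tensor_module_def]
  have rel: "bilinear_relations R M N \<subseteq> tensor_relations R M N"
    unfolding tensor_relations_def
    by (rule generated_submodule(2)[OF module_free_module bilinear_relations_closed[OF assms]])
  note g = free_generator_closed[where X = "carrier M \<times> carrier N"]
  note eqI = coset_eqI[OF module_free_module sub _ _ subsetD[OF rel]]
  show "pure_tensor R M N m n \<in> carrier (tensor_module R M N)" if "m \<in> carrier M" "n \<in> carrier N"
    using that g
    by (auto simp: pure_tensor_def tensor_module_def mem_quotient_carrier[OF module_free_module sub])
  show "pure_tensor R M N (m \<oplus>\<^bsub>M\<^esub> m') n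
      = pure_tensor R M N m n \<oplus>\<^bsub>tensor_module R M N\<^esub> pure_tensor R M N m' n"
    if mn: "m \<in> carrier M" "m' \<in> carrier M" "n \<in> carrier N"
  proof -
    have "free_generator R (m \<oplus>\<^bsub>M\<^esub> m', n) \<ominus>\<^bsub>?F\<^esub>
        (free_generator R (m, n) \<oplus>\<^bsub>?F\<^esub> free_generator R (m', n)) \<in> bilinear_relations R M N"
      unfolding bilinear_relations_def Let_def using mn by blast
    from eqI[OF _ _ this] show ?thesis unfolding pure_tensor_def using mn g by (simp add: ops)
  qed
  show "pure_tensor R M N m (n \<oplus>\<^bsub>N\<^esub> n')
      = pure_tensor R M N m n \<oplus>\<^bsub>tensor_module R M N\<^esub> pure_tensor R M N m n'"
    if mn: "m \<in> carrier M" "n \<in> carrier N" "n' \<in> carrier N"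
  proof -
    have "free_generator R (m, n \<oplus>\<^bsub>N\<^esub> n') \<ominus>\<^bsub>?F\<^esub>
        (free_generator R (m, n) \<oplus>\<^bsub>?F\<^esub> free_generator R (m, n')) \<in> bilinear_relations R M N"
      unfolding bilinear_relations_def Let_def using mn by blast
    from eqI[OF _ _ this] show ?thesis unfolding pure_tensor_def using mn g by (simp add: ops)
  qed
  assume a: "a \<in> carrier R" and mn: "m \<in> carrier M" "n \<in> carrier N"
  show "pure_tensor R M N (a \<odot>\<^bsub>M\<^esub> m) n = a \<odot>\<^bsub>tensor_module R M N\<^esub> pure_tensor R M N m n"
  proof -
    have "free_generator R (a \<odot>\<^bsub>M\<^esub> m, n) \<ominus>\<^bsub>?F\<^esub> a \<odot>\<^bsub>?F\<^esub> free_generator R (m, n)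
        \<in> bilinear_relations R M N"
      unfolding bilinear_relations_def Let_def using a mn by blast
    from eqI[OF _ _ this] show ?thesis unfolding pure_tensor_def using a mn g by (simp add: ops)
  qed
  show "pure_tensor R M N m (a \<odot>\<^bsub>N\<^esub> n) = a \<odot>\<^bsub>tensor_module R M N\<^esub> pure_tensor R M N m n"
  proof -
    have "free_generator R (m, a \<odot>\<^bsub>N\<^esub> n) \<ominus>\<^bsub>?F\<^esub> a \<odot>\<^bsub>?F\<^esub> free_generator R (m, n)
        \<in> bilinear_relations R M N"
      unfolding bilinear_relations_def Let_def using a mn by blast
    from eqI[OF _ _ this] show ?thesis unfolding pure_tensor_def using a mn g by (simp add: ops)
  qed
qed

end

locale bilinear_map = M?: module R M + N?: module R N + P?: module R P
  for R (structure) and M :: "('a, 'b, 'n) module_scheme" and N :: "('a, 'c, 'p) module_scheme"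
    and P :: "('a, 'd, 'q) module_scheme" +
  fixes \<beta> :: "'b \<Rightarrow> 'c \<Rightarrow> 'd"
  assumes bilinear_closed: "m \<in> carrier M \<Longrightarrow> n \<in> carrier N \<Longrightarrow> \<beta> m n \<in> carrier P"
    and bilinear_add_left: "m \<in> carrier M \<Longrightarrow> m' \<in> carrier M \<Longrightarrow> n \<in> carrier N \<Longrightarrow>
      \<beta> (m \<oplus>\<^bsub>M\<^esub> m') n = \<beta> m n \<oplus>\<^bsub>P\<^esub> \<beta> m' n"
    and bilinear_add_right: "m \<in> carrier M \<Longrightarrow> n \<in> carrier N \<Longrightarrow> n' \<in> carrier N \<Longrightarrow>
      \<beta> m (n \<oplus>\<^bsub>N\<^esub> n') = \<beta> m n \<oplus>\<^bsub>P\<^esub> \<beta> m n'"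
    and bilinear_smult_left: "a \<in> carrier R \<Longrightarrow> m \<in> carrier M \<Longrightarrow> n \<in> carrier N \<Longrightarrow>
      \<beta> (a \<odot>\<^bsub>M\<^esub> m) n = a \<odot>\<^bsub>P\<^esub> \<beta> m n"
    and bilinear_smult_right: "a \<in> carrier R \<Longrightarrow> m \<in> carrier M \<Longrightarrow> n \<in> carrier N \<Longrightarrow>
      \<beta> m (a \<odot>\<^bsub>N\<^esub> n) = a \<odot>\<^bsub>P\<^esub> \<beta> m n"
begin

abbreviation (input) "free \<equiv> free_module R (carrier M \<times> carrier N)"

lemma extension_linear: "free_extension R P (\<lambda>(m, n). \<beta> m n) \<in> linear_maps R free P"
  by (rule R.free_extension_linear[OF P.module_axioms]) (auto simp: bilinear_closed)

lemma extension_generator: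
  "m \<in> carrier M \<Longrightarrow> n \<in> carrier N \<Longrightarrow>
    free_extension R P (\<lambda>(m, n). \<beta> m n) (free_generator R (m, n)) = \<beta> m n"
  by (subst R.free_extension_generator[OF P.module_axioms, where X = "carrier M \<times> carrier N"])
    (auto simp: bilinear_closed)

lemma extension_relations:
  assumes "f \<in> tensor_relations R M N"
  shows "free_extension R P (\<lambda>(m, n). \<beta> m n) f = \<zero>\<^bsub>P\<^esub>"
proof -
  interpret F: module R free by (rule R.module_free_module)
  note g = R.free_generator_closed[where X = "carrier M \<times> carrier N"]
  let ?E = "free_extension R P (\<lambda>(m, n). \<beta> m n)"
  let ?K = "{f \<in> carrier free. ?E f = \<zero>\<^bsub>P\<^esub>}"
  have sub: "bilinear_relations R M N \<subseteq> carrier free"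
    by (rule R.bilinear_relations_closed[OF M.module_axioms N.module_axioms])
  have zero: "x \<ominus>\<^bsub>P\<^esub> x = \<zero>\<^bsub>P\<^esub>" if "x \<in> carrier P" for x
    using that by (simp add: a_minus_def P.M.r_neg)
  have "bilinear_relations R M N \<subseteq> ?K"
  proof
    fix f assume f: "f \<in> bilinear_relations R M N"
    have "?E f = \<zero>\<^bsub>P\<^esub>"
      using f unfolding bilinear_relations_def Let_def
      by (auto simp: linear_maps_minus[OF F.module_axioms P.module_axioms extension_linear]
          linear_mapsD[OF extension_linear] g extension_generator bilinear_add_left bilinear_add_right
          bilinear_smult_left bilinear_smult_right bilinear_closed zero)
    then show "f \<in> ?K" using f sub by auto
  qed
  then have "tensor_relations R M N \<subseteq> ?K"
    unfolding tensor_relations_def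
    by (intro R.generated_submodule(3)[OF F.module_axioms sub]
        kernel_submodule[OF F.module_axioms P.module_axioms extension_linear])
  then show ?thesis using assms by auto
qed

lemma tensor_lift_coset:
  assumes f: "f \<in> carrier free"
  shows "tensor_lift R P \<beta> (tensor_relations R M N +>\<^bsub>free\<^esub> f) = free_extension R P (\<lambda>(m, n). \<beta> m n) f"
proof -
  interpret F: module R free by (rule R.module_free_module)
  have sub: "submodule (tensor_relations R M N) R free"
    by (rule R.tensor_relations_submodule[OF M.module_axioms N.module_axioms])
  let ?E = "free_extension R P (\<lambda>(m, n). \<beta> m n)"
  have "?E (h \<oplus>\<^bsub>free\<^esub> f) = ?E f" if h: "h \<in> tensor_relations R M N" for h
    using h f F.submoduleE(1)[OF sub] linear_mapsD[OF extension_linear] extension_relations[OF h]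
    by (auto simp: subset_iff)
  moreover have "tensor_relations R M N \<noteq> {}" using F.submoduleE(2)[OF sub] .
  ultimately have "?E ` (tensor_relations R M N +>\<^bsub>free\<^esub> f) = {?E f}"
    by (auto simp: a_r_coset_def' image_UN)
  then show ?thesis by (simp add: tensor_lift_def)
qed

lemma tensor_lift_pure:
  assumes "m \<in> carrier M" "n \<in> carrier N"
  shows "tensor_lift R P \<beta> (pure_tensor R M N m n) = \<beta> m n"
  using tensor_lift_coset[OF R.free_generator_closed[of "(m, n)"]] assms
  by (simp add: pure_tensor_def extension_generator)

lemma tensor_lift_linear: "tensor_lift R P \<beta> \<in> linear_maps R (tensor_module R M N) P"
proof -
  interpret F: module R free by (rule R.module_free_module)
  have sub: "submodule (tensor_relations R M N) R free"
    by (rule R.tensor_relations_submodule[OF M.module_axioms N.module_axioms])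
  note mem = R.mem_quotient_carrier[OF F.module_axioms sub, folded tensor_module_def]
  note ops = R.quotient_module_ops[OF F.module_axioms sub, folded tensor_module_def]
  show ?thesis
    by (rule linear_mapsI)
      (auto simp: mem ops tensor_lift_coset linear_mapsD[OF extension_linear])
qed

end

context cring
begin

lemma linear_maps_tensor_eqI:
  assumes "module R M" "module R N" "module R P"
    and f: "f \<in> linear_maps R (tensor_module R M N) P" and g: "g \<in> linear_maps R (tensor_module R M N) P"
    and eq: "\<And>m n. m \<in> carrier M \<Longrightarrow> n \<in> carrier N \<Longrightarrow> f (pure_tensor R M N m n) = g (pure_tensor R M N m n)"
    and t: "t \<in> carrier (tensor_module R M N)"
  shows "f t = g t"
proof -
  let ?X = "carrier M \<times> carrier N"
  let ?F = "free_module R ?X"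
  interpret F: module R ?F by (rule module_free_module)
  interpret P: module R P by fact
  have sub: "submodule (tensor_relations R M N) R ?F"
    by (rule tensor_relations_submodule[OF assms(1,2)])
  note mem = mem_quotient_carrier[OF F.module_axioms sub, folded tensor_module_def]
  note ops = quotient_module_ops[OF F.module_axioms sub, folded tensor_module_def]
  let ?\<pi> = "\<lambda>x. tensor_relations R M N +>\<^bsub>?F\<^esub> x"
  have pi: "?\<pi> \<in> linear_maps R ?F (tensor_module R M N)"
    by (rule linear_mapsI) (auto simp: mem ops)
  obtain x where x: "x \<in> carrier ?F" "t = ?\<pi> x" using t by (auto simp: mem)
  have S: "finite {y. x y \<noteq> \<zero>}" "{y. x y \<noteq> \<zero>} \<subseteq> ?X" "\<And>y. x y \<in> carrier R"
    using x(1) by (auto simp: free_module_def)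
  have "h (?\<pi> x) = (\<Oplus>\<^bsub>P\<^esub>y\<in>{y. x y \<noteq> \<zero>}. x y \<odot>\<^bsub>P\<^esub> h (?\<pi> (free_generator R y)))"
    if h: "h \<in> linear_maps R (tensor_module R M N) P" for h
  proof -
    have gen: "free_generator R y \<in> carrier ?F" if "x y \<noteq> \<zero>" for y
      using that S(2) by (auto intro: free_generator_closed)
    have lin: "(\<lambda>x. h (?\<pi> x)) \<in> linear_maps R ?F P"
      by (rule linear_mapsI) (auto simp: linear_mapsD[OF h] linear_mapsD[OF pi])
    have cl: "(\<lambda>y. x y \<odot>\<^bsub>?F\<^esub> free_generator R y) \<in> {y. x y \<noteq> \<zero>} \<rightarrow> carrier ?F"
      using S by (auto intro!: F.smult_closed free_generator_closed)
    have "h (?\<pi> x) = h (?\<pi> (\<Oplus>\<^bsub>?F\<^esub>y\<in>{y. x y \<noteq> \<zero>}. x y \<odot>\<^bsub>?F\<^esub> free_generator R y))"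
      using free_module_expansion[OF x(1)] by (simp add: free_extension_def)
    also have "\<dots> = (\<Oplus>\<^bsub>P\<^esub>y\<in>{y. x y \<noteq> \<zero>}. h (?\<pi> (x y \<odot>\<^bsub>?F\<^esub> free_generator R y)))"
      by (rule linear_maps_finsum[OF F.module_axioms assms(3) lin S(1) cl])
    also have "\<dots> = (\<Oplus>\<^bsub>P\<^esub>y\<in>{y. x y \<noteq> \<zero>}. x y \<odot>\<^bsub>P\<^esub> h (?\<pi> (free_generator R y)))"
      using S gen linear_mapsD(1,3)[OF lin]
      by (intro P.M.finsum_cong') (simp_all add: Pi_iff)
    finally show ?thesis .
  qed
  note expand = this
  have gen: "f (?\<pi> (free_generator R y)) = g (?\<pi> (free_generator R y))" if "y \<in> ?X" for y
    using that eq by (auto simp: pure_tensor_def)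
  show ?thesis
    unfolding x(2) expand[OF f] expand[OF g]
  proof (rule P.M.finsum_cong')
    fix y assume "y \<in> {y. x y \<noteq> \<zero>}"
    then have "y \<in> ?X" using S(2) by blast
    then show "x y \<odot>\<^bsub>P\<^esub> f (?\<pi> (free_generator R y)) = x y \<odot>\<^bsub>P\<^esub> g (?\<pi> (free_generator R y))"
      by (simp only: gen)
  next
    show "(\<lambda>y. x y \<odot>\<^bsub>P\<^esub> g (?\<pi> (free_generator R y))) \<in> {y. x y \<noteq> \<zero>} \<rightarrow> carrier P"
    proof
      fix y assume "y \<in> {y. x y \<noteq> \<zero>}"
      then have "free_generator R y \<in> carrier ?F" using S(2) by (auto intro: free_generator_closed)
      then show "x y \<odot>\<^bsub>P\<^esub> g (?\<pi> (free_generator R y)) \<in> carrier P"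
        using S(3) linear_mapsD(1)[OF g] linear_mapsD(1)[OF pi] by simp
    qed
  qed simp
qed

lemma tensor_map_bilinear:
  assumes "module R M" "module R N" "module R M'" "module R N'"
    and "f \<in> linear_maps R M M'" "g \<in> linear_maps R N N'"
  shows "bilinear_map R M N (tensor_module R M' N') (\<lambda>m n. pure_tensor R M' N' (f m) (g n))"
proof -
  interpret T: module R "tensor_module R M' N'" by (rule module_tensor_module[OF assms(3,4)])
  show ?thesis
    using assms(1,2) T.module_axioms
    by (auto intro!: bilinear_map.intro bilinear_map_axioms.intro
        simp: linear_mapsD[OF assms(5)] linear_mapsD[OF assms(6)] pure_tensor_bilinear[OF assms(3,4)])
qed

lemma tensor_map_linear:
  assumes "module R M" "module R N" "module R M'" "module R N'"
    and "f \<in> linear_maps R M M'" "g \<in> linear_maps R N N'"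
  shows "tensor_map R M' N' f g \<in> linear_maps R (tensor_module R M N) (tensor_module R M' N')"
  unfolding tensor_map_def by (rule bilinear_map.tensor_lift_linear[OF tensor_map_bilinear[OF assms]])

lemma tensor_map_pure:
  assumes "module R M" "module R N" "module R M'" "module R N'"
    and "f \<in> linear_maps R M M'" "g \<in> linear_maps R N N'" and "m \<in> carrier M" "n \<in> carrier N"
  shows "tensor_map R M' N' f g (pure_tensor R M N m n) = pure_tensor R M' N' (f m) (g n)"
  unfolding tensor_map_def
  by (rule bilinear_map.tensor_lift_pure[OF tensor_map_bilinear[OF assms(1-6)] assms(7,8)])

lemma tensor_assoc_inner_bilinear:
  assumes "module R M" "module R N" "module R P" "p \<in> carrier P"
  shows "bilinear_map R M N (tensor_module R M (tensor_module R N P))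
    (\<lambda>m n. pure_tensor R M (tensor_module R N P) m (pure_tensor R N P n p))"
proof -
  note T = module_tensor_module[OF assms(2,3)]
  show ?thesis
    using assms module_tensor_module[OF assms(1) T]
    by (auto intro!: bilinear_map.intro bilinear_map_axioms.intro
        simp: pure_tensor_bilinear[OF assms(2,3)] pure_tensor_bilinear[OF assms(1) T])
qed

lemma tensor_assoc_bilinear:
  assumes "module R M" "module R N" "module R P"
  shows "bilinear_map R (tensor_module R M N) P (tensor_module R M (tensor_module R N P))
    (\<lambda>t p. tensor_lift R (tensor_module R M (tensor_module R N P))
      (\<lambda>m n. pure_tensor R M (tensor_module R N P) m (pure_tensor R N P n p)) t)"
proof -
  note T = module_tensor_module[OF assms(2,3)]
  note TT = module_tensor_module[OF assms(1) T]
  note TM = module_tensor_module[OF assms(1,2)]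
  interpret TT: module R "tensor_module R M (tensor_module R N P)" by (rule TT)
  interpret P: module R P by fact
  note inner = tensor_assoc_inner_bilinear[OF assms]
  note lin = bilinear_map.tensor_lift_linear[OF inner]
  note pure = bilinear_map.tensor_lift_pure[OF inner]
  note pb = pure_tensor_bilinear[OF assms(2,3)] pure_tensor_bilinear[OF assms(1) T]
  let ?L = "\<lambda>p. tensor_lift R (tensor_module R M (tensor_module R N P))
      (\<lambda>m n. pure_tensor R M (tensor_module R N P) m (pure_tensor R N P n p))"
  show ?thesis
  proof (rule bilinear_map.intro[OF TM assms(3) TT bilinear_map_axioms.intro])
    fix t p p' assume t: "t \<in> carrier (tensor_module R M N)" and p: "p \<in> carrier P" "p' \<in> carrier P"
    have pp: "p \<oplus>\<^bsub>P\<^esub> p' \<in> carrier P" using p by simp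
    have l: "(\<lambda>t. ?L p t \<oplus>\<^bsub>tensor_module R M (tensor_module R N P)\<^esub> ?L p' t)
        \<in> linear_maps R (tensor_module R M N) (tensor_module R M (tensor_module R N P))"
      by (rule linear_mapsI)
        (auto simp: linear_mapsD[OF lin[OF p(1)]] linear_mapsD[OF lin[OF p(2)]] TT.M.a_ac TT.smult_r_distr)
    show "?L (p \<oplus>\<^bsub>P\<^esub> p') t = ?L p t \<oplus>\<^bsub>tensor_module R M (tensor_module R N P)\<^esub> ?L p' t"
      by (rule linear_maps_tensor_eqI[OF assms(1,2) TT lin[OF pp] l _ t])
        (simp add: pure pp p pb)
  next
    fix a t p assume t: "t \<in> carrier (tensor_module R M N)" and p: "p \<in> carrier P" and a: "a \<in> carrier R"
    have pp: "a \<odot>\<^bsub>P\<^esub> p \<in> carrier P" using p a by simp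
    have l: "(\<lambda>t. a \<odot>\<^bsub>tensor_module R M (tensor_module R N P)\<^esub> ?L p t)
        \<in> linear_maps R (tensor_module R M N) (tensor_module R M (tensor_module R N P))"
      using a by (intro linear_mapsI)
        (auto simp: linear_mapsD[OF lin[OF p(1)]] TT.smult_r_distr TT.smult_assoc1[symmetric] m_comm)
    show "?L (a \<odot>\<^bsub>P\<^esub> p) t = a \<odot>\<^bsub>tensor_module R M (tensor_module R N P)\<^esub> ?L p t"
      by (rule linear_maps_tensor_eqI[OF assms(1,2) TT lin[OF pp] l _ t])
        (simp add: pure pp p pb a)
  qed (auto simp: linear_mapsD[OF lin])
qed

lemma tensor_assoc_linear:
  assumes "module R M" "module R N" "module R P"
  shows "tensor_assoc R M N P \<in> linear_maps R (tensor_module R (tensor_module R M N) P)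
    (tensor_module R M (tensor_module R N P))"
  unfolding tensor_assoc_def by (rule bilinear_map.tensor_lift_linear[OF tensor_assoc_bilinear[OF assms]])

lemma tensor_assoc_pure:
  assumes "module R M" "module R N" "module R P" "m \<in> carrier M" "n \<in> carrier N" "p \<in> carrier P"
  shows "tensor_assoc R M N P (pure_tensor R (tensor_module R M N) P (pure_tensor R M N m n) p)
    = pure_tensor R M (tensor_module R N P) m (pure_tensor R N P n p)"
  using assms
  by (simp add: tensor_assoc_def bilinear_map.tensor_lift_pure[OF tensor_assoc_bilinear]
      bilinear_map.tensor_lift_pure[OF tensor_assoc_inner_bilinear] pure_tensor_bilinear)

end

lemma (in coalgebra) coalgebra_auto_inverse:
  assumes "f \<in> coalgebra_autos R C"
  shows "restrict (inv_into (carrier C) f) (carrier C) \<in> coalgebra_autos R C"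
proof -
  have lin: "f \<in> linear_maps R C C" and bij: "bij_betw f (carrier C) (carrier C)"
    and comp: "\<And>c. c \<in> carrier C \<Longrightarrow> comult C (f c) = tensor_map R C C f f (comult C c)"
      "\<And>c. c \<in> carrier C \<Longrightarrow> counit C (f c) = counit C c"
    using assms by (auto simp: coalgebra_autos_def Bij_def)
  note pure = tensor_map_pure[OF module_axioms module_axioms module_axioms module_axioms]
  have T: "module R (tensor_module R C C)" by (rule module_tensor_module[OF module_axioms module_axioms])
  let ?g = "restrict (inv_into (carrier C) f) (carrier C)"
  have g: "?g c \<in> carrier C" "f (?g c) = c" if "c \<in> carrier C" for c
    using that bij by (auto simp: bij_betw_def intro: inv_into_into f_inv_into_f)
  have gf: "?g (f c) = c" if "c \<in> carrier C" for c
    using that bij by (auto simp: bij_betw_def)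
  have gf': "inv_into (carrier C) f (f c) = c" if "c \<in> carrier C" for c
    using gf[OF that] linear_mapsD(1)[OF lin that] by simp
  have glin: "?g \<in> linear_maps R C C"
  proof (rule linear_mapsI)
    fix x y assume "x \<in> carrier C" "y \<in> carrier C"
    then show "?g (x \<oplus>\<^bsub>C\<^esub> y) = ?g x \<oplus>\<^bsub>C\<^esub> ?g y"
      using gf[of "?g x \<oplus>\<^bsub>C\<^esub> ?g y"] g linear_mapsD(2)[OF lin, of "?g x" "?g y"] by simp
  next
    fix a x assume "a \<in> carrier R" "x \<in> carrier C"
    then show "?g (a \<odot>\<^bsub>C\<^esub> x) = a \<odot>\<^bsub>C\<^esub> ?g x"
      using gf[of "a \<odot>\<^bsub>C\<^esub> ?g x"] g linear_mapsD(3)[OF lin, of a "?g x"] by simp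
  qed (rule g)
  note tl = tensor_map_linear[OF module_axioms module_axioms module_axioms module_axioms]
  have tinv: "tensor_map R C C ?g ?g (tensor_map R C C f f t) = t"
    if t: "t \<in> carrier (tensor_module R C C)" for t
  proof -
    have "(\<lambda>t. tensor_map R C C ?g ?g (tensor_map R C C f f t))
        \<in> linear_maps R (tensor_module R C C) (tensor_module R C C)"
      by (rule linear_mapsI) (auto simp: linear_mapsD[OF tl[OF lin lin]] linear_mapsD[OF tl[OF glin glin]])
    moreover have "(\<lambda>t. t) \<in> linear_maps R (tensor_module R C C) (tensor_module R C C)"
      by (rule linear_mapsI) auto
    ultimately show ?thesis
      by (rule linear_maps_tensor_eqI[OF module_axioms module_axioms T _ _ _ t])
        (simp add: pure[OF lin lin] pure[OF glin glin] linear_mapsD(1)[OF lin] gf')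
  qed
  have "comult C (?g c) = tensor_map R C C ?g ?g (comult C c)" if c: "c \<in> carrier C" for c
    using comp(1)[OF g(1)[OF c]] g(2)[OF c] tinv linear_mapsD(1)[OF comult_linear g(1)[OF c]] by simp
  moreover have "counit C (?g c) = counit C c" if "c \<in> carrier C" for c
    using comp(2)[OF g(1)[OF that]] g(2)[OF that] by simp
  moreover have "?g \<in> Bij (carrier C)"
    using assms by (intro restrict_inv_into_Bij) (simp add: coalgebra_autos_def)
  ultimately show ?thesis using glin by (simp add: coalgebra_autos_def)
qed

lemma (in coalgebra) coalgebra_autos_subgroup:
  "subgroup (coalgebra_autos R C) (BijGroup (carrier C))"
proof (rule subgroup.intro)
  note pure = tensor_map_pure[OF module_axioms module_axioms module_axioms module_axioms]
  note tl = tensor_map_linear[OF module_axioms module_axioms module_axioms module_axioms]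
  have T: "module R (tensor_module R C C)" by (rule module_tensor_module[OF module_axioms module_axioms])
  show "coalgebra_autos R C \<subseteq> carrier (BijGroup (carrier C))"
    by (auto simp: coalgebra_autos_def BijGroup_def)
  show "\<one>\<^bsub>BijGroup (carrier C)\<^esub> \<in> coalgebra_autos R C"
  proof -
    let ?i = "\<lambda>x\<in>carrier C. x"
    have i: "?i \<in> linear_maps R C C" by (rule linear_mapsI) auto
    have "tensor_map R C C ?i ?i t = t" if t: "t \<in> carrier (tensor_module R C C)" for t
    proof (rule linear_maps_tensor_eqI[OF module_axioms module_axioms T tl[OF i i] _ _ t])
      show "(\<lambda>t. t) \<in> linear_maps R (tensor_module R C C) (tensor_module R C C)"
        by (rule linear_mapsI) auto
    qed (simp add: pure[OF i i])
    then show ?thesis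
      using i linear_mapsD(1)[OF comult_linear] by (simp add: coalgebra_autos_def BijGroup_def id_Bij)
  qed
  fix f assume f: "f \<in> coalgebra_autos R C"
  then show "inv\<^bsub>BijGroup (carrier C)\<^esub> f \<in> coalgebra_autos R C"
    using coalgebra_auto_inverse[OF f] by (subst inv_BijGroup) (auto simp: coalgebra_autos_def)
  fix g assume g: "g \<in> coalgebra_autos R C"
  have fl: "f \<in> linear_maps R C C" and gl: "g \<in> linear_maps R C C"
    using f g by (auto simp: coalgebra_autos_def)
  let ?h = "compose (carrier C) f g"
  have h: "?h \<in> linear_maps R C C"
    by (rule linear_mapsI) (auto simp: compose_def linear_mapsD[OF fl] linear_mapsD[OF gl])
  have comp: "tensor_map R C C ?h ?h t = tensor_map R C C f f (tensor_map R C C g g t)"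
    if t: "t \<in> carrier (tensor_module R C C)" for t
  proof (rule linear_maps_tensor_eqI[OF module_axioms module_axioms T tl[OF h h] _ _ t])
    show "(\<lambda>t. tensor_map R C C f f (tensor_map R C C g g t))
        \<in> linear_maps R (tensor_module R C C) (tensor_module R C C)"
      by (rule linear_mapsI) (auto simp: linear_mapsD[OF tl[OF fl fl]] linear_mapsD[OF tl[OF gl gl]])
  qed (simp add: pure[OF h h] pure[OF fl fl] pure[OF gl gl] linear_mapsD(1)[OF gl] compose_eq)
  have "?h \<in> coalgebra_autos R C"
    using f g h comp linear_mapsD(1)[OF gl] linear_mapsD(1)[OF comult_linear]
    by (auto simp: coalgebra_autos_def compose_Bij compose_eq)
  then show "f \<otimes>\<^bsub>BijGroup (carrier C)\<^esub> g \<in> coalgebra_autos R C"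
    using f g by (auto simp: coalgebra_autos_def BijGroup_def)
qed

lemma (in coalgebra) group_coalgebra_AutoGroup: "group (coalgebra_AutoGroup R C)"
  unfolding coalgebra_AutoGroup_def
  by (rule subgroup.subgroup_is_group[OF coalgebra_autos_subgroup group_BijGroup])

lemma (in coalgebra) coalgebra_auto_grouplikes:
  assumes f: "f \<in> coalgebra_autos R C"
  shows "f ` grouplikes R C = grouplikes R C"
proof -
  have sub: "h ` grouplikes R C \<subseteq> grouplikes R C" if h: "h \<in> coalgebra_autos R C" for h
    using h linear_mapsD(1)[of h R C C]
      tensor_map_pure[OF module_axioms module_axioms module_axioms module_axioms, of h h]
    by (auto simp: grouplikes_def coalgebra_autos_def)
  have "bij_betw f (carrier C) (carrier C)" using f by (auto simp: coalgebra_autos_def Bij_def)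
  then have "f (restrict (inv_into (carrier C) f) (carrier C) c) = c" if "c \<in> grouplikes R C" for c
    using that by (auto simp: grouplikes_def bij_betw_def f_inv_into_f)
  with sub[OF f] sub[OF coalgebra_auto_inverse[OF f]] show ?thesis by (metis image_subset_iff subsetI subset_antisym image_eqI)
qed

lemma (in coalgebra) grouplike_restriction_hom:
  "grouplike_restriction R C \<in> hom (coalgebra_AutoGroup R C) (BijGroup (grouplikes R C))"
proof (rule homI)
  have Bij: "grouplike_restriction R C f \<in> Bij (grouplikes R C)" if f: "f \<in> coalgebra_autos R C" for f
  proof -
    have "inj_on f (grouplikes R C)"
      using f by (auto simp: coalgebra_autos_def Bij_def bij_betw_def grouplikes_def intro: inj_on_subset)
    then show ?thesis
      using coalgebra_auto_grouplikes[OF f]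
      by (auto simp: Bij_def grouplike_restriction_def bij_betw_def inj_on_def)
  qed
  fix f assume f: "f \<in> carrier (coalgebra_AutoGroup R C)"
  then show "grouplike_restriction R C f \<in> carrier (BijGroup (grouplikes R C))"
    using Bij by (simp add: coalgebra_AutoGroup_def BijGroup_def)
  fix g assume g: "g \<in> carrier (coalgebra_AutoGroup R C)"
  have fg: "f \<in> coalgebra_autos R C" "g \<in> coalgebra_autos R C"
    using f g by (auto simp: coalgebra_AutoGroup_def)
  then have "f \<in> Bij (carrier C)" "g \<in> Bij (carrier C)" by (auto simp: coalgebra_autos_def)
  moreover have "g x \<in> grouplikes R C" if "x \<in> grouplikes R C" for x
    using coalgebra_auto_grouplikes[OF fg(2)] that by blast
  moreover have "x \<in> carrier C" if "x \<in> grouplikes R C" for x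
    using that by (simp add: grouplikes_def)
  ultimately show "grouplike_restriction R C (f \<otimes>\<^bsub>coalgebra_AutoGroup R C\<^esub> g)
    = grouplike_restriction R C f \<otimes>\<^bsub>BijGroup (grouplikes R C)\<^esub> grouplike_restriction R C g"
    using Bij[OF fg(1)] Bij[OF fg(2)]
    by (auto simp: coalgebra_AutoGroup_def BijGroup_def grouplike_restriction_def compose_def
        intro!: restrict_ext)
qed

end

theory Submission
  imports Defs
begin

text \<open>
  A loopless quiver without parallel arrows yields a coalgebra whose basis consists of its vertices,
  which are grouplike, and its arrows, with \<open>\<Delta> e = s e \<otimes> e + e \<otimes> t e\<close>. There are no other
  grouplikes, and an element \<open>c\<close> with \<open>\<Delta> c = p \<otimes> c + c \<otimes> q\<close> for vertices \<open>p \<noteq> q\<close> is a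
  combination of \<open>p - q\<close> and of the arrow from \<open>p\<close> to \<open>q\<close>, if there is one. Hence an automorphism
  induces an automorphism of the quiver, and the remaining freedom is a scalar from \<open>k\<^sup>\<times>\<close>
  and a multiple of \<open>s e - t e\<close> for every arrow \<open>e\<close>, that is, one factor \<open>k \<rtimes> k\<^sup>\<times>\<close> for each arrow.

  A quiver with automorphism group \<open>G\<close> has vertex set \<open>G \<times> G\<close>. Fix a well-order on \<open>G\<close>. Put
  single arrows \<open>(x, g) \<rightarrow> (x, h)\<close> for \<open>g < h\<close>, and arrows in both directions between \<open>(x, g)\<close> and
  \<open>(x g, 1)\<close> for \<open>g \<noteq> 1\<close>. The single arrows turn the sets \<open>{x} \<times> G\<close> into well-orders, which are
  rigid, so an automorphism has the form \<open>(x, g) \<mapsto> (f x, g)\<close>; the double arrows force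
  \<open>f (x g) = f x g\<close>, so \<open>f\<close> is a left translation.
\<close>

section \<open>Linear maps on free modules\<close>

lemma linear_maps_compose:
  assumes "f \<in> linear_maps R M N" "g \<in> linear_maps R N P"
  shows "(\<lambda>x. g (f x)) \<in> linear_maps R M P"
  by (rule linear_mapsI) (simp_all add: linear_mapsD[OF assms(1)] linear_mapsD[OF assms(2)])

lemma linear_maps_id: "(\<lambda>x. x) \<in> linear_maps R M M"
  by (rule linear_mapsI) simp_all

text \<open>Every element is a finite combination of generators, and a linear map passes through
  such a sum, so its values on \<open>X\<close> determine it.\<close>

lemma (in cring) linear_maps_free_eqI:
  assumes "module R P" "f \<in> linear_maps R (free_module R X) P" "g \<in> linear_maps R (free_module R X) P"
    and "\<And>x. x \<in> X \<Longrightarrow> f (free_generator R x) = g (free_generator R x)"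
    and c: "c \<in> carrier (free_module R X)"
  shows "f c = g c"
proof -
  let ?F = "free_module R X"
  interpret F: module R ?F by (rule module_free_module)
  interpret P: module R P by fact
  have S: "finite {x. c x \<noteq> \<zero>}" "\<And>x. c x \<noteq> \<zero> \<Longrightarrow> x \<in> X" "\<And>x. c x \<in> carrier R"
    using c by (auto simp: free_module_def)
  have cl: "(\<lambda>x. c x \<odot>\<^bsub>?F\<^esub> free_generator R x) \<in> {x. c x \<noteq> \<zero>} \<rightarrow> carrier ?F"
    using S by (auto intro!: F.smult_closed free_generator_closed)
  have expand: "h c = (\<Oplus>\<^bsub>P\<^esub>x\<in>{x. c x \<noteq> \<zero>}. h (c x \<odot>\<^bsub>?F\<^esub> free_generator R x))"
    if h: "h \<in> linear_maps R ?F P" for h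
    using linear_maps_finsum[OF F.module_axioms assms(1) h S(1) cl] free_module_expansion[OF c]
    by (simp add: free_extension_def)
  show ?thesis
    unfolding expand[OF assms(2)] expand[OF assms(3)]
  proof (rule P.M.finsum_cong')
    show "(\<lambda>x. g (c x \<odot>\<^bsub>?F\<^esub> free_generator R x)) \<in> {x. c x \<noteq> \<zero>} \<rightarrow> carrier P"
      using cl linear_mapsD(1)[OF assms(3)] by blast
  qed (auto simp: linear_mapsD(3)[OF assms(2)] linear_mapsD(3)[OF assms(3)] S free_generator_closed assms(4))
qed

lemma (in cring) pure_tensor_zero_left:
  assumes "module R M" "module R N" "n \<in> carrier N"
  shows "pure_tensor R M N \<zero>\<^bsub>M\<^esub> n = \<zero>\<^bsub>tensor_module R M N\<^esub>"
proof -
  interpret M: module R M by fact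
  interpret MN: module R "tensor_module R M N" by (rule module_tensor_module[OF assms(1,2)])
  have "(\<lambda>m. pure_tensor R M N m n) \<in> linear_maps R M (tensor_module R M N)"
    by (rule linear_mapsI) (simp_all add: pure_tensor_bilinear[OF assms(1,2)] assms(3))
  from linear_maps_zero[OF assms(1) MN.module_axioms this] show ?thesis .
qed

lemma (in cring) pure_tensor_zero_right:
  assumes "module R M" "module R N" "m \<in> carrier M"
  shows "pure_tensor R M N m \<zero>\<^bsub>N\<^esub> = \<zero>\<^bsub>tensor_module R M N\<^esub>"
proof -
  interpret M: module R M by fact
  interpret MN: module R "tensor_module R M N" by (rule module_tensor_module[OF assms(1,2)])
  have "(\<lambda>n. pure_tensor R M N m n) \<in> linear_maps R N (tensor_module R M N)"
    by (rule linear_mapsI) (simp_all add: pure_tensor_bilinear[OF assms(1,2)] assms(3))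
  from linear_maps_zero[OF assms(2) MN.module_axioms this] show ?thesis .
qed

section \<open>The coalgebra of a simple quiver\<close>

text \<open>Vertices and arrows form one basis inside a single type, and every basis element outside
  \<open>V\<close> is treated as an arrow. The comultiplication is written over the free module
  \<open>M\<close>, because the coalgebra record is still under construction;
  \<open>tensor_C\<close> later replaces \<open>M\<close> by the coalgebra itself.\<close>

definition quiver_coalgebra ::
  "('k, 'm) ring_scheme \<Rightarrow> 'x set \<Rightarrow> 'x set \<Rightarrow> ('x \<Rightarrow> 'x) \<Rightarrow> ('x \<Rightarrow> 'x) \<Rightarrow> ('k, 'x \<Rightarrow> 'k) coalgebra"
  where "quiver_coalgebra R V A s t =
    (let M = free_module R (V \<union> A); \<delta> = free_generator R; T = tensor_module R M M in
      \<lparr>carrier = carrier M, monoid.mult = monoid.mult M, one = one M,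
       ring.zero = ring.zero M, add = add M, smult = smult M,
       comult = free_extension R T
         (\<lambda>x. if x \<in> V then pure_tensor R M M (\<delta> x) (\<delta> x)
              else pure_tensor R M M (\<delta> (s x)) (\<delta> x) \<oplus>\<^bsub>T\<^esub> pure_tensor R M M (\<delta> x) (\<delta> (t x))),
       counit = free_extension R (ring_as_module R) (\<lambda>x. if x \<in> V then \<one>\<^bsub>R\<^esub> else \<zero>\<^bsub>R\<^esub>)\<rparr>)"

locale simple_quiver = field R for R :: "('k, 'm) ring_scheme" (structure) +
  fixes V A :: "'x set" and s t :: "'x \<Rightarrow> 'x"
  assumes disjoint: "x \<in> V \<Longrightarrow> x \<notin> A"
    and source: "e \<in> A \<Longrightarrow> s e \<in> V" and target: "e \<in> A \<Longrightarrow> t e \<in> V"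
    and no_loop: "e \<in> A \<Longrightarrow> s e \<noteq> t e"
    and simple: "e \<in> A \<Longrightarrow> e' \<in> A \<Longrightarrow> s e = s e' \<Longrightarrow> t e = t e' \<Longrightarrow> e = e'"
begin

abbreviation (input) "C \<equiv> quiver_coalgebra R V A s t"
abbreviation (input) "\<delta> \<equiv> free_generator R"
abbreviation (input) "pure \<equiv> pure_tensor R C C"
abbreviation (input) "k \<equiv> ring_as_module R"

section \<open>Linear structure of the quiver coalgebra and its coalgebra axioms\<close>

lemma carrier_C: "carrier C = carrier (free_module R (V \<union> A))"
  by (simp add: quiver_coalgebra_def Let_def)

lemma ops_C:
  "(\<zero>\<^bsub>C\<^esub>) = (\<lambda>x. \<zero>)" "f \<oplus>\<^bsub>C\<^esub> g = (\<lambda>x. f x \<oplus> g x)" "a \<odot>\<^bsub>C\<^esub> f = (\<lambda>x. a \<otimes> f x)"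
  by (simp_all add: quiver_coalgebra_def Let_def free_module_def)

lemma module_C: "module R C"
proof -
  let ?F = "free_module R (V \<union> A)"
  have eq: "carrier C = carrier ?F" "add C = add ?F" "\<zero>\<^bsub>C\<^esub> = \<zero>\<^bsub>?F\<^esub>" "smult C = smult ?F"
    by (simp_all add: quiver_coalgebra_def Let_def)
  interpret F: module R ?F by (rule module_free_module)
  show ?thesis
  proof (rule moduleI)
    show "abelian_group C"
    proof (rule abelian_groupI)
      fix f assume "f \<in> carrier C"
      then show "\<exists>g\<in>carrier C. g \<oplus>\<^bsub>C\<^esub> f = \<zero>\<^bsub>C\<^esub>"
        using F.M.l_neg by (auto simp: eq intro!: bexI[of _ "\<ominus>\<^bsub>?F\<^esub> f"])
    qed (simp_all add: eq F.M.a_ac)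
  qed (simp_all add: eq is_cring F.smult_l_distr F.smult_r_distr F.smult_assoc1)
qed

sublocale C: module R C by (rule module_C)

lemma module_T: "module R (tensor_module R C C)"
  by (rule module_tensor_module[OF module_C module_C])

sublocale T: module R "tensor_module R C C" by (rule module_T)

lemma module_k: "module R k"
  by (rule ring_as_module[OF is_cring])

sublocale k: module R k by (rule module_k)

lemma k_simps:
  "carrier k = carrier R" "add k = add R" "\<zero>\<^bsub>k\<^esub> = \<zero>" "smult k = monoid.mult R"
  by (simp_all add: ring_as_module_def)

lemma linear_C: "linear_maps R (free_module R (V \<union> A)) P = linear_maps R C P"
  by (simp add: linear_maps_def quiver_coalgebra_def Let_def)

text \<open>The relations defining a tensor product see only carriers, addition and scalar
  multiplication, and these agree for \<open>M\<close> and \<open>C\<close>.\<close>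

lemma tensor_C:
  fixes M :: "('k, 'x \<Rightarrow> 'k) module"
  assumes "M = free_module R (V \<union> A)"
  shows "tensor_module R M M = tensor_module R C C" "pure_tensor R M M = pure"
proof -
  have "bilinear_relations R M M = bilinear_relations R C C"
    by (simp add: assms bilinear_relations_def quiver_coalgebra_def Let_def)
  then show "tensor_module R M M = tensor_module R C C" "pure_tensor R M M = pure"
    by (simp_all add: tensor_module_def tensor_relations_def pure_tensor_def fun_eq_iff carrier_C assms)
qed

lemma comult_C: "comult C = free_extension R (tensor_module R C C)
   (\<lambda>x. if x \<in> V then pure (\<delta> x) (\<delta> x)
              else pure (\<delta> (s x)) (\<delta> x) \<oplus>\<^bsub>tensor_module R C C\<^esub> pure (\<delta> x) (\<delta> (t x)))"
  by (subst (1) quiver_coalgebra_def) (simp add: Let_def tensor_C[OF refl] cong: if_cong)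

lemma counit_C: "counit C = free_extension R k (\<lambda>x. if x \<in> V then \<one> else \<zero>)"
  by (simp add: quiver_coalgebra_def Let_def)

lemma \<delta>_closed: "x \<in> V \<Longrightarrow> \<delta> x \<in> carrier C" "x \<in> A \<Longrightarrow> \<delta> x \<in> carrier C"
  by (auto simp: carrier_C free_generator_closed)

text \<open>The basis consists of vertices and arrows, so identities between linear maps, from
  coassociativity to the multiplicativity of \<open>\<Phi>\<close>, come down to these two
  cases.\<close>

lemma C_eqI:
  assumes "module R P" "f \<in> linear_maps R C P" "g \<in> linear_maps R C P"
    and "\<And>x. x \<in> V \<Longrightarrow> f (\<delta> x) = g (\<delta> x)" "\<And>x. x \<in> A \<Longrightarrow> f (\<delta> x) = g (\<delta> x)"
    and "c \<in> carrier C"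
  shows "f c = g c"
  using linear_maps_free_eqI[of P f "V \<union> A" g c] assms by (auto simp: linear_C carrier_C)

lemma extension_C:
  assumes "module R P" "\<And>x. x \<in> V \<Longrightarrow> \<beta> x \<in> carrier P" "\<And>x. x \<in> A \<Longrightarrow> \<beta> x \<in> carrier P"
  shows "free_extension R P \<beta> \<in> linear_maps R C P"
    and "x \<in> V \<Longrightarrow> free_extension R P \<beta> (\<delta> x) = \<beta> x"
    and "x \<in> A \<Longrightarrow> free_extension R P \<beta> (\<delta> x) = \<beta> x"
  using free_extension_linear[OF assms(1), of \<beta> "V \<union> A"]
    free_extension_generator[OF assms(1), of \<beta> "V \<union> A"] assms(2,3)
  by (auto simp: linear_C)

lemmas pure_bilinear = pure_tensor_bilinear[OF module_C module_C]

lemma comult_linear: "comult C \<in> linear_maps R C (tensor_module R C C)"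
  unfolding comult_C
  by (rule extension_C(1)[OF module_T]) (auto simp: pure_bilinear \<delta>_closed source target disjoint)

lemma comult_V: "x \<in> V \<Longrightarrow> comult C (\<delta> x) = pure (\<delta> x) (\<delta> x)"
  unfolding comult_C
  by (subst extension_C(2)[OF module_T]) (auto simp: pure_bilinear \<delta>_closed source target disjoint)

lemma comult_A: "x \<in> A \<Longrightarrow> comult C (\<delta> x)
    = pure (\<delta> (s x)) (\<delta> x) \<oplus>\<^bsub>tensor_module R C C\<^esub> pure (\<delta> x) (\<delta> (t x))"
  unfolding comult_C using disjoint
  by (subst extension_C(3)[OF module_T]) (auto simp: pure_bilinear \<delta>_closed source target)

lemma counit_linear: "counit C \<in> linear_maps R C k"
  unfolding counit_C by (rule extension_C(1)[OF module_k]) (auto simp: k_simps)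

lemma counit_V: "x \<in> V \<Longrightarrow> counit C (\<delta> x) = \<one>"
  unfolding counit_C by (subst extension_C(2)[OF module_k]) (auto simp: k_simps)

lemma counit_A: "x \<in> A \<Longrightarrow> counit C (\<delta> x) = \<zero>"
  unfolding counit_C using disjoint by (subst extension_C(3)[OF module_k]) (auto simp: k_simps)

text \<open>All maps involved are linear, so the axioms are checked on the basis. For an arrow
  \<open>e\<close> from \<open>p\<close> to \<open>q\<close> both iterated comultiplications equal
  \<open>p \<otimes> p \<otimes> e + p \<otimes> e \<otimes> q + e \<otimes> q \<otimes> q\<close>.
  The counit is 1 on vertices and 0 on arrows, so exactly one summand of
  \<open>p \<otimes> e + e \<otimes> q\<close> survives on either side.\<close>

lemma coalgebra_C: "coalgebra R C"
proof -
  note TC = module_tensor_module[OF module_T module_C] and CT = module_tensor_module[OF module_C module_T]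
  note kC = module_tensor_module[OF module_k module_C] and Ck = module_tensor_module[OF module_C module_k]
  interpret TC: module R "tensor_module R (tensor_module R C C) C" by (rule TC)
  interpret CT: module R "tensor_module R C (tensor_module R C C)" by (rule CT)
  interpret kC: module R "tensor_module R k C" by (rule kC)
  interpret Ck: module R "tensor_module R C k" by (rule Ck)
  note d = \<delta>_closed source target
  note lin = linear_mapsD[OF tensor_assoc_linear[OF module_C module_C module_C]]
    linear_mapsD[OF tensor_map_linear[OF module_C module_C module_T module_C comult_linear linear_maps_id]]
    linear_mapsD[OF tensor_map_linear[OF module_C module_C module_C module_T linear_maps_id comult_linear]]
    linear_mapsD[OF tensor_map_linear[OF module_C module_C module_k module_C counit_linear linear_maps_id]]
    linear_mapsD[OF tensor_map_linear[OF module_C module_C module_C module_k linear_maps_id counit_linear]]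
    linear_mapsD[OF comult_linear]
  note pt = tensor_assoc_pure[OF module_C module_C module_C]
    tensor_map_pure[OF module_C module_C module_T module_C comult_linear linear_maps_id]
    tensor_map_pure[OF module_C module_C module_C module_T linear_maps_id comult_linear]
    tensor_map_pure[OF module_C module_C module_k module_C counit_linear linear_maps_id]
    tensor_map_pure[OF module_C module_C module_C module_k linear_maps_id counit_linear]
  note bil = pure_bilinear pure_tensor_bilinear[OF module_C module_T] pure_tensor_bilinear[OF module_T module_C]
    pure_tensor_bilinear[OF module_k module_C] pure_tensor_bilinear[OF module_C module_k]
  have one: "\<one> \<in> carrier k" by (simp add: k_simps)
  note zero = pure_tensor_zero_left[OF module_k module_C, unfolded k_simps] pure_tensor_zero_right[OF module_C module_k, unfolded k_simps]
  show ?thesis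
  proof (intro coalgebra.intro coalgebra_axioms.intro module_C comult_linear counit_linear)
    fix c assume c: "c \<in> carrier C"
    show "tensor_assoc R C C C (tensor_map R (tensor_module R C C) C (comult C) (\<lambda>x. x) (comult C c))
      = tensor_map R C (tensor_module R C C) (\<lambda>x. x) (comult C) (comult C c)"
      by (rule C_eqI[OF CT linear_mapsI linear_mapsI _ _ c])
        (simp_all add: comult_V comult_A d lin pt bil CT.a_assoc)
    show "tensor_map R k C (counit C) (\<lambda>x. x) (comult C c) = pure_tensor R k C \<one> c"
      by (rule C_eqI[OF kC linear_mapsI linear_mapsI _ _ c])
        (simp_all add: one zero comult_V comult_A counit_V counit_A d lin pt bil)
    show "tensor_map R C k (\<lambda>x. x) (counit C) (comult C c) = pure_tensor R C k c \<one>"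
      by (rule C_eqI[OF Ck linear_mapsI linear_mapsI _ _ c])
        (simp_all add: one zero comult_V comult_A counit_V counit_A d lin pt bil)
  qed
qed

section \<open>Tensor coordinates, grouplike elements and skew-primitive elements\<close>

lemma coeff_closed: "c \<in> carrier C \<Longrightarrow> c x \<in> carrier R"
  by (simp add: carrier_C free_module_def)

lemma coeff_outside: "c \<in> carrier C \<Longrightarrow> x \<notin> V \<Longrightarrow> x \<notin> A \<Longrightarrow> c x = \<zero>"
  by (auto simp: carrier_C free_module_def)

text \<open>Negation in a module is given only as an additive inverse; rewritten as scaling by
  \<open>-1\<close> it can be read off coefficientwise.\<close>

lemma minus_C:
  assumes "c \<in> carrier C" "d \<in> carrier C"
  shows "(c \<ominus>\<^bsub>C\<^esub> d) x = c x \<ominus> d x"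
proof -
  have "\<ominus>\<^bsub>C\<^esub> d = (\<ominus> \<one>) \<odot>\<^bsub>C\<^esub> d" using assms by (simp add: C.smult_l_minus)
  then show ?thesis using coeff_closed[OF assms(2)] by (simp add: a_minus_def ops_C l_minus)
qed

lemma free_generator_inj: "\<delta> x = \<delta> y \<Longrightarrow> x = y"
  by (metis free_generator_def one_not_zero)

text \<open>The coefficient of a tensor at \<open>\<delta> x \<otimes> \<delta> y\<close>. These
  functionals turn equations in the tensor square into scalar equations, without a basis of the
  tensor square having to be constructed.\<close>

definition coord :: "'x \<Rightarrow> 'x \<Rightarrow> ('k, 'x \<Rightarrow> 'k, 'x \<Rightarrow> 'k) tensor \<Rightarrow> 'k"
  where "coord x y = tensor_lift R k (\<lambda>c d. c x \<otimes> d y)"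

lemma coord_bilinear: "bilinear_map R C C k (\<lambda>c d. c x \<otimes> d y)"
  by (intro bilinear_map.intro module_C module_k bilinear_map_axioms.intro)
    (simp_all add: ops_C k_simps coeff_closed l_distr r_distr m_assoc m_lcomm)

lemma coord_linear: "coord x y \<in> linear_maps R (tensor_module R C C) k"
  unfolding coord_def by (rule bilinear_map.tensor_lift_linear[OF coord_bilinear])

lemma coord_pure: "c \<in> carrier C \<Longrightarrow> d \<in> carrier C \<Longrightarrow> coord x y (pure c d) = c x \<otimes> d y"
  unfolding coord_def by (rule bilinear_map.tensor_lift_pure[OF coord_bilinear])

lemma coord_add: "T \<in> carrier (tensor_module R C C) \<Longrightarrow> T' \<in> carrier (tensor_module R C C) \<Longrightarrow>
    coord x y (T \<oplus>\<^bsub>tensor_module R C C\<^esub> T') = coord x y T \<oplus> coord x y T'"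
  using linear_mapsD(2)[OF coord_linear] by (simp add: k_simps)

text \<open>Each \<open>\<delta> x \<otimes> \<delta> y\<close> occurs in the comultiplication of at
  most one basis element: a vertex \<open>x = y\<close>, the arrow \<open>y\<close> if
  \<open>x\<close> is its source, or the arrow \<open>x\<close> if \<open>y\<close> is its target.
  As \<open>V\<close> and \<open>A\<close> are disjoint, these cases exclude each other, so every
  coordinate is a single coefficient of \<open>c\<close> or zero.\<close>

lemma coord_comult:
  assumes "c \<in> carrier C"
  shows "coord x y (comult C c) =
    (if x \<in> V \<and> y = x \<or> y \<in> A \<and> x = s y then c y else if x \<in> A \<and> y = t x then c x else \<zero>)"
    (is "_ = ?r c")
proof (rule C_eqI[OF module_k _ _ _ _ assms])
  show "(\<lambda>c. coord x y (comult C c)) \<in> linear_maps R C k"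
    by (rule linear_maps_compose[OF comult_linear coord_linear])
  \<comment> \<open>The conditions do not involve \<open>c\<close>, so the right side is an
    evaluation map or zero and hence linear.\<close>
  have "(\<lambda>c. if P then c y else if Q then c x else \<zero>) \<in> linear_maps R C k" for P Q
    by (rule linear_mapsI) (simp_all add: ops_C k_simps coeff_closed)
  then show "?r \<in> linear_maps R C k" .
  fix z
  show "coord x y (comult C (\<delta> z)) = ?r (\<delta> z)" if z: "z \<in> V"
  proof -
    have "coord x y (comult C (\<delta> z)) = (if x = z \<and> y = z then \<one> else \<zero>)"
      using z by (simp add: comult_V coord_pure \<delta>_closed) (simp add: free_generator_def)
    also have "\<dots> = ?r (\<delta> z)"
      using z disjoint by (cases "y = z"; cases "x = z") (simp_all add: free_generator_def)
    finally show ?thesis .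
  qed
  show "coord x y (comult C (\<delta> z)) = ?r (\<delta> z)" if z: "z \<in> A"
  proof -
    have st: "s z \<noteq> z" "t z \<noteq> z" "z \<notin> V" "s z \<notin> A" "t z \<notin> A"
      using z source[OF z] target[OF z] disjoint by metis+
    have sy: "z \<noteq> s y" if "y \<in> A" using source[OF that] st(3) by metis
    have "coord x y (comult C (\<delta> z)) = \<delta> (s z) x \<otimes> \<delta> z y \<oplus> \<delta> z x \<otimes> \<delta> (t z) y"
      using z source[OF z] target[OF z]
      by (simp add: comult_A coord_add pure_bilinear coord_pure \<delta>_closed)
    also have "\<dots> = (if x = s z \<and> y = z \<or> x = z \<and> y = t z then \<one> else \<zero>)"
      using st by (simp add: free_generator_def)
    also have "\<dots> = ?r (\<delta> z)"
      using z st sy by (cases "y = z"; cases "x = z") (simp_all add: free_generator_def)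
    finally show ?thesis .
  qed
qed

text \<open>Comparing coordinates of \<open>c \<otimes> c\<close> and of the comultiplication,
  squares of arrow coefficients vanish, vertex coefficients are idempotent, and products over
  distinct vertices vanish. In a field this leaves at most one vertex, with coefficient 1, and the
  counit rules out \<open>c = 0\<close>.\<close>

lemma grouplikes_C: "grouplikes R C = \<delta> ` V"
proof
  show "\<delta> ` V \<subseteq> grouplikes R C"
    by (auto simp: grouplikes_def \<delta>_closed comult_V counit_V)
  show "grouplikes R C \<subseteq> \<delta> ` V"
  proof
    fix c assume "c \<in> grouplikes R C"
    then have c: "c \<in> carrier C" "comult C c = pure c c" "counit C c = \<one>"
      by (auto simp: grouplikes_def)
    have coord: "c x \<otimes> c y = (if x \<in> V \<and> y = x \<or> y \<in> A \<and> x = s y then c y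
        else if x \<in> A \<and> y = t x then c x else \<zero>)" for x y
      using coord_comult[OF c(1), of x y] coord_pure[OF c(1) c(1), of x y] c(2) by simp
    have A: "c x = \<zero>" if "x \<in> A" for x
    proof -
      have "s x \<noteq> x" "t x \<noteq> x" using that disjoint source target by metis+
      then have "c x \<otimes> c x = \<zero>" using coord[of x x] disjoint that by auto
      then show ?thesis using integral coeff_closed[OF c(1)] by blast
    qed
    have "c \<noteq> \<zero>\<^bsub>C\<^esub>"
      using c(3) linear_maps_zero[OF module_C module_k counit_linear] by (auto simp: k_simps)
    then obtain v where v: "c v \<noteq> \<zero>" by (auto simp: ops_C)
    then have vV: "v \<in> V" using A coeff_outside[OF c(1)] by blast
    have "c v \<otimes> c v = c v \<otimes> \<one>" using coord[of v v] vV coeff_closed[OF c(1)] by simp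
    then have "c v = \<one>" using v coeff_closed[OF c(1)] m_lcancel by blast
    moreover have "c x = \<zero>" if "x \<noteq> v" for x
    proof (cases "x \<in> V")
      case True
      then have "c v \<otimes> c x = \<zero>" using coord[of v x] vV that disjoint by auto
      then show ?thesis using v integral coeff_closed[OF c(1)] by blast
    qed (use A coeff_outside[OF c(1)] in blast)
    ultimately have "c = \<delta> v" by (auto simp: free_generator_def)
    then show "c \<in> \<delta> ` V" using vV by blast
  qed
qed

text \<open>For an arrow \<open>e\<close> in the support of \<open>c\<close>, the coordinates at
  \<open>(s e, e)\<close> and \<open>(e, t e)\<close> force \<open>s e = p\<close> and
  \<open>t e = q\<close>, so by simplicity there is at most one such arrow. Diagonal coordinates
  remove all vertices except \<open>p\<close> and \<open>q\<close>.\<close>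

lemma skew_primitive:
  assumes p: "p \<in> V" and q: "q \<in> V" and pq: "p \<noteq> q" and c: "c \<in> carrier C"
    and comult: "comult C c = pure (\<delta> p) c \<oplus>\<^bsub>tensor_module R C C\<^esub> pure c (\<delta> q)"
  obtains "c = c p \<odot>\<^bsub>C\<^esub> (\<delta> p \<ominus>\<^bsub>C\<^esub> \<delta> q)"
  | e where "e \<in> A" "s e = p" "t e = q" "c e \<noteq> \<zero>"
      "c = c e \<odot>\<^bsub>C\<^esub> \<delta> e \<oplus>\<^bsub>C\<^esub> c p \<odot>\<^bsub>C\<^esub> (\<delta> p \<ominus>\<^bsub>C\<^esub> \<delta> q)"
proof -
  have cl: "c x \<in> carrier R" for x by (rule coeff_closed[OF c])
  have coord: "(if x = p then c y else \<zero>) \<oplus> (if y = q then c x else \<zero>) =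
      (if x \<in> V \<and> y = x \<or> y \<in> A \<and> x = s y then c y
        else if x \<in> A \<and> y = t x then c x else \<zero>)" for x y
  proof -
    have "coord x y (comult C c) = \<delta> p x \<otimes> c y \<oplus> c x \<otimes> \<delta> q y"
      by (simp add: comult coord_add coord_pure pure_bilinear \<delta>_closed p q c)
    also have "\<dots> = (if x = p then c y else \<zero>) \<oplus> (if y = q then c x else \<zero>)"
      using cl by (simp add: free_generator_def)
    finally show ?thesis using coord_comult[OF c, of x y] by simp
  qed
  have A: "s e = p \<and> t e = q" if "e \<in> A" "c e \<noteq> \<zero>" for e
  proof -
    have "t e \<notin> A" "e \<notin> V" "e \<noteq> q" "e \<noteq> p"
      using that(1) disjoint target p q by metis+
    then show ?thesis
      using coord[of "s e" e] coord[of e "t e"] that cl by (auto split: if_splits)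
  qed
  have V: "c x = \<zero>" if "x \<in> V" "x \<noteq> p" "x \<noteq> q" for x
    using coord[of x x] that by auto
  \<comment> \<open>No basis element has \<open>\<delta> p \<otimes> \<delta> q\<close> in its
    comultiplication, so this coordinate ties the coefficients at \<open>p\<close> and
    \<open>q\<close> together.\<close>
  have "q \<notin> A" "p \<notin> A" using disjoint p q by auto
  then have "c q \<oplus> c p = \<zero>" using coord[of p q] pq by auto
  then have cq: "c q = \<ominus> c p" using cl by (simp add: minus_equality)
  have d: "(\<delta> p \<ominus>\<^bsub>C\<^esub> \<delta> q) x = (if x = p then \<one> else if x = q then \<ominus> \<one> else \<zero>)" for x
    using pq p q by (simp add: minus_C \<delta>_closed) (simp add: free_generator_def a_minus_def)
  show ?thesis
  proof (cases "\<exists>e\<in>A. c e \<noteq> \<zero>")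
    case True
    then obtain e where e: "e \<in> A" "c e \<noteq> \<zero>" by blast
    have st: "s e = p" "t e = q" using A[OF e] by auto
    have ne: "e \<noteq> p" "e \<noteq> q" using disjoint p q e(1) by auto
    have other: "c x = \<zero>" if "x \<noteq> e" "x \<noteq> p" "x \<noteq> q" for x
      using that V A[of x] simple[OF e(1), of x] st coeff_outside[OF c, of x] by blast
    have "c x = (c e \<odot>\<^bsub>C\<^esub> \<delta> e \<oplus>\<^bsub>C\<^esub> c p \<odot>\<^bsub>C\<^esub> (\<delta> p \<ominus>\<^bsub>C\<^esub> \<delta> q)) x" for x
      using ne pq other[of x] cq cl by (simp add: ops_C d) (auto simp: free_generator_def r_minus)
    then show ?thesis using that(2)[OF e(1) st e(2)] by blast
  next
    case False
    then have "c x = (c p \<odot>\<^bsub>C\<^esub> (\<delta> p \<ominus>\<^bsub>C\<^esub> \<delta> q)) x" for x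
      using pq V[of x] coeff_outside[OF c, of x] cq cl by (auto simp: ops_C d r_minus)
    then show ?thesis using that(1) by blast
  qed
qed

section \<open>Coalgebra automorphisms act on the quiver\<close>

lemma coalgebra_autosD:
  assumes "f \<in> coalgebra_autos R C"
  shows "f \<in> linear_maps R C C" "inj_on f (carrier C)" "f \<in> extensional (carrier C)"
    and "c \<in> carrier C \<Longrightarrow> comult C (f c) = tensor_map R C C f f (comult C c)"
  using assms by (auto simp: coalgebra_autos_def Bij_def bij_betw_def)

text \<open>Since \<open>f\<close> respects comultiplication, \<open>f (\<delta> e)\<close> is
  skew-primitive from \<open>p\<close> to \<open>q\<close>, and \<open>skew_primitive\<close>
  describes it; injectivity of \<open>f\<close> guarantees that an arrow really occurs.\<close>

lemma auto_arrow:
  assumes f: "f \<in> coalgebra_autos R C" and e: "e \<in> A" and p: "p \<in> V" and q: "q \<in> V"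
    and fs: "f (\<delta> (s e)) = \<delta> p" and ft: "f (\<delta> (t e)) = \<delta> q"
  shows "\<exists>e'\<in>A. s e' = p \<and> t e' = q \<and> (\<exists>u\<in>Units R. \<exists>a\<in>carrier R.
    f (\<delta> e) = inv u \<odot>\<^bsub>C\<^esub> (\<delta> e' \<oplus>\<^bsub>C\<^esub> a \<odot>\<^bsub>C\<^esub> (\<delta> p \<ominus>\<^bsub>C\<^esub> \<delta> q)))"
proof -
  note lin = coalgebra_autosD(1)[OF f]
  note st = source[OF e] target[OF e]
  have cl: "f (\<delta> e) \<in> carrier C" using linear_mapsD(1)[OF lin] e by (simp add: \<delta>_closed)
  have pq: "p \<noteq> q"
    using fs ft no_loop[OF e] free_generator_inj inj_onD[OF coalgebra_autosD(2)[OF f]] st \<delta>_closed(1)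
    by metis
  have "comult C (f (\<delta> e)) = pure (\<delta> p) (f (\<delta> e)) \<oplus>\<^bsub>tensor_module R C C\<^esub> pure (f (\<delta> e)) (\<delta> q)"
    using coalgebra_autosD(4)[OF f \<delta>_closed(2)[OF e]] e st fs ft
    by (simp add: comult_A \<delta>_closed pure_bilinear
        linear_mapsD(2)[OF tensor_map_linear[OF module_C module_C module_C module_C lin lin]]
        tensor_map_pure[OF module_C module_C module_C module_C lin lin])
  from skew_primitive[OF p q pq cl this] show ?thesis
  proof cases
    case 1
    let ?a = "f (\<delta> e) p"
    have a: "?a \<in> carrier R" by (rule coeff_closed[OF cl])
    \<comment> \<open>Without an arrow component, this combination of vertices would have the same
      image as \<open>\<delta> e\<close>, although its coefficient at \<open>e\<close> is 0.\<close>
    let ?d = "?a \<odot>\<^bsub>C\<^esub> (\<delta> (s e) \<ominus>\<^bsub>C\<^esub> \<delta> (t e))"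
    have "f ?d = f (\<delta> e)"
      using 1 a st by (simp add: linear_mapsD[OF lin] linear_maps_minus[OF module_C module_C lin] \<delta>_closed fs ft)
    then have "?d = \<delta> e"
      using inj_onD[OF coalgebra_autosD(2)[OF f]] a st e by (simp add: \<delta>_closed)
    moreover have "(\<delta> (s e) \<ominus>\<^bsub>C\<^esub> \<delta> (t e)) e = \<zero>"
      using st e disjoint by (auto simp: minus_C \<delta>_closed) (auto simp: free_generator_def a_minus_def)
    then have "?d e = \<zero>" using a by (simp add: ops_C)
    ultimately show ?thesis by (simp add: free_generator_def)
  next
    case (2 e')
    \<comment> \<open>\<open>?l\<close> is the coefficient of the image arrow. Taking it out as a
      common factor divides the coefficient at \<open>p\<close> by \<open>?l\<close>; its inverse is
      the unit asked for, in line with the inverted scalar in \<open>arrow_image\<close>.\<close>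
    let ?u = "inv (f (\<delta> e) e')" and ?l = "f (\<delta> e) e'" and ?a = "f (\<delta> e) p"
    have l: "?l \<in> Units R" using 2 coeff_closed[OF cl] by (simp add: field_Units)
    have a: "?a \<in> carrier R" by (rule coeff_closed[OF cl])
    have "?l \<odot>\<^bsub>C\<^esub> (\<delta> e' \<oplus>\<^bsub>C\<^esub> (?u \<otimes> ?a) \<odot>\<^bsub>C\<^esub> (\<delta> p \<ominus>\<^bsub>C\<^esub> \<delta> q))
      = ?l \<odot>\<^bsub>C\<^esub> \<delta> e' \<oplus>\<^bsub>C\<^esub> (?l \<otimes> (?u \<otimes> ?a)) \<odot>\<^bsub>C\<^esub> (\<delta> p \<ominus>\<^bsub>C\<^esub> \<delta> q)"
      using a l 2(1) p q by (simp add: C.smult_r_distr C.smult_assoc1 \<delta>_closed Units_closed)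
    also have "?l \<otimes> (?u \<otimes> ?a) = ?a" using a l by (simp add: m_assoc[symmetric] Units_closed)
    also have "?l \<odot>\<^bsub>C\<^esub> \<delta> e' \<oplus>\<^bsub>C\<^esub> ?a \<odot>\<^bsub>C\<^esub> (\<delta> p \<ominus>\<^bsub>C\<^esub> \<delta> q) = f (\<delta> e)"
      by (rule 2(5)[symmetric])
    finally have eq: "?l \<odot>\<^bsub>C\<^esub> (\<delta> e' \<oplus>\<^bsub>C\<^esub> (?u \<otimes> ?a) \<odot>\<^bsub>C\<^esub> (\<delta> p \<ominus>\<^bsub>C\<^esub> \<delta> q)) = f (\<delta> e)" .
    have u: "?u \<in> Units R" and ua: "?u \<otimes> ?a \<in> carrier R" using l a by simp_all
    have "f (\<delta> e) = inv ?u \<odot>\<^bsub>C\<^esub> (\<delta> e' \<oplus>\<^bsub>C\<^esub> (?u \<otimes> ?a) \<odot>\<^bsub>C\<^esub> (\<delta> p \<ominus>\<^bsub>C\<^esub> \<delta> q))"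
      by (subst Units_inv_inv[OF l]) (rule eq[symmetric])
    then show ?thesis by (rule_tac bexI[OF _ 2(1)], intro conjI 2(2,3), rule_tac bexI[OF _ u], rule_tac bexI[OF _ ua])
  qed
qed

text \<open>The permutation of the grouplikes is the permutation \<open>\<sigma>\<close> of the
  vertices. \<open>auto_arrow\<close> applied to \<open>f\<close> shows that arrows are preserved,
  and applied to the inverse automorphism that they are reflected.\<close>

lemma auto_vertices:
  assumes f: "f \<in> coalgebra_autos R C"
  obtains \<sigma> where "bij_betw \<sigma> V V" "\<And>v. v \<in> V \<Longrightarrow> f (\<delta> v) = \<delta> (\<sigma> v)"
    "\<And>v w. v \<in> V \<Longrightarrow> w \<in> V \<Longrightarrow>
      (\<exists>e\<in>A. s e = v \<and> t e = w) \<longleftrightarrow> (\<exists>e\<in>A. s e = \<sigma> v \<and> t e = \<sigma> w)"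
proof -
  interpret coalgebra R C by (rule coalgebra_C)
  let ?g = "restrict (inv_into (carrier C) f) (carrier C)"
  have g: "?g \<in> coalgebra_autos R C" by (rule coalgebra_auto_inverse[OF f])
  have gf: "?g (f c) = c" if "c \<in> carrier C" for c
    using that coalgebra_autosD(2)[OF f] linear_mapsD(1)[OF coalgebra_autosD(1)[OF f]] by simp
  have ex: "\<exists>w\<in>V. h (\<delta> v) = \<delta> w" if "h \<in> coalgebra_autos R C" "v \<in> V" for h v
    using coalgebra_auto_grouplikes[OF that(1)] that(2) unfolding grouplikes_C by blast
  obtain \<sigma> where \<sigma>: "\<And>v. v \<in> V \<Longrightarrow> \<sigma> v \<in> V" "\<And>v. v \<in> V \<Longrightarrow> f (\<delta> v) = \<delta> (\<sigma> v)"
    using ex[OF f] by metis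
  have g\<sigma>: "?g (\<delta> (\<sigma> v)) = \<delta> v" if "v \<in> V" for v
    using gf[of "\<delta> v"] \<sigma>(2) that \<delta>_closed(1) by simp
  have "inj_on \<sigma> V" using g\<sigma> free_generator_inj by (metis inj_onI)
  moreover have "\<sigma> ` V = V"
  proof
    show "V \<subseteq> \<sigma> ` V"
    proof
      fix w assume "w \<in> V"
      then obtain v where "v \<in> V" "f (\<delta> v) = \<delta> w"
        using coalgebra_auto_grouplikes[OF f] unfolding grouplikes_C by (metis (no_types, lifting) image_iff)
      then show "w \<in> \<sigma> ` V" using \<sigma>(2) free_generator_inj by (metis imageI)
    qed
  qed (use \<sigma>(1) in blast)
  ultimately have "bij_betw \<sigma> V V" by (simp add: bij_betw_def)
  moreover have "(\<exists>e\<in>A. s e = v \<and> t e = w) \<longleftrightarrow> (\<exists>e\<in>A. s e = \<sigma> v \<and> t e = \<sigma> w)"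
    if v: "v \<in> V" and w: "w \<in> V" for v w
  proof (intro iffI; elim bexE conjE)
    show "\<exists>e'\<in>A. s e' = \<sigma> v \<and> t e' = \<sigma> w" if "e \<in> A" "s e = v" "t e = w" for e
      using auto_arrow[OF f that(1) \<sigma>(1)[OF v] \<sigma>(1)[OF w]] \<sigma>(2)[OF v] \<sigma>(2)[OF w] that by blast
    show "\<exists>e'\<in>A. s e' = v \<and> t e' = w" if e: "e \<in> A" "s e = \<sigma> v" "t e = \<sigma> w" for e
    proof -
      have "?g (\<delta> (s e)) = \<delta> v" "?g (\<delta> (t e)) = \<delta> w"
        by (simp_all only: e g\<sigma>[OF v] g\<sigma>[OF w])
      from auto_arrow[OF g e(1) v w this] show ?thesis by blast
    qed
  qed
  ultimately show ?thesis using that \<sigma>(2) by blast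
qed

end

section \<open>Automorphisms over a group acting on the quiver\<close>

text \<open>In a quiver without parallel arrows an automorphism is determined by its effect on
  vertices. Hence \<open>act_faithful\<close> and \<open>act_full\<close>, which speak of vertices
  only, identify \<open>G\<close> with the full automorphism group of the quiver.\<close>

locale quiver_action = simple_quiver R V A s t + G: group G
  for R :: "('k, 'm) ring_scheme" (structure) and V A :: "'x set" and s t :: "'x \<Rightarrow> 'x"
    and G :: "('g, 'n) monoid_scheme" +
  fixes act :: "'g \<Rightarrow> 'x \<Rightarrow> 'x"
  assumes act_V: "g \<in> carrier G \<Longrightarrow> x \<in> V \<Longrightarrow> act g x \<in> V"
    and act_A: "g \<in> carrier G \<Longrightarrow> x \<in> A \<Longrightarrow> act g x \<in> A"
    and act_source: "g \<in> carrier G \<Longrightarrow> x \<in> A \<Longrightarrow> s (act g x) = act g (s x)"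
    and act_target: "g \<in> carrier G \<Longrightarrow> x \<in> A \<Longrightarrow> t (act g x) = act g (t x)"
    and act_mult: "g \<in> carrier G \<Longrightarrow> h \<in> carrier G \<Longrightarrow> x \<in> V \<union> A \<Longrightarrow>
      act (g \<otimes>\<^bsub>G\<^esub> h) x = act g (act h x)"
    and act_one: "x \<in> V \<union> A \<Longrightarrow> act \<one>\<^bsub>G\<^esub> x = x"
    and act_faithful: "g \<in> carrier G \<Longrightarrow> h \<in> carrier G \<Longrightarrow> (\<And>v. v \<in> V \<Longrightarrow> act g v = act h v) \<Longrightarrow> g = h"
    and act_full: "bij_betw \<sigma> V V \<Longrightarrow> (\<And>v w. v \<in> V \<Longrightarrow> w \<in> V \<Longrightarrow>
      (\<exists>e\<in>A. s e = v \<and> t e = w) \<longleftrightarrow> (\<exists>e\<in>A. s e = \<sigma> v \<and> t e = \<sigma> w)) \<Longrightarrow>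
      \<exists>g\<in>carrier G. \<forall>v\<in>V. \<sigma> v = act g v"
begin

abbreviation (input) "K \<equiv> product_group A (\<lambda>_. affine_group R)"

section \<open>The product \<open>K\<close> of affine groups and the action of \<open>G\<close> on
  it\<close>

lemma affine_group_simps:
  "carrier (affine_group R) = carrier R \<times> Units R"
  "u \<in> Units R \<Longrightarrow> b \<in> carrier R \<Longrightarrow>
    (a, u) \<otimes>\<^bsub>affine_group R\<^esub> (b, v) = (a \<oplus> u \<otimes> b, u \<otimes> v)"
  "\<one>\<^bsub>affine_group R\<^esub> = (\<zero>, \<one>)"
  by (simp_all add: affine_group_def semidirect_product_def units_of_def)

lemma group_K: "group K"
  using group_affine_group[OF is_cring] by (rule product_group)

sublocale K: group K by (rule group_K)

lemma K_mem: "\<kappa> \<in> carrier K \<Longrightarrow> e \<in> A \<Longrightarrow> \<kappa> e \<in> carrier (affine_group R)"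
  by (auto simp: product_group_def)

lemma K_coeffs:
  assumes "\<kappa> \<in> carrier K" "e \<in> A"
  shows "fst (\<kappa> e) \<in> carrier R" "snd (\<kappa> e) \<in> Units R"
  using K_mem[OF assms] by (auto simp: affine_group_simps)

lemma act_inv:
  assumes "g \<in> carrier G" "x \<in> V \<union> A"
  shows "act (inv\<^bsub>G\<^esub> g) (act g x) = x" "act g (act (inv\<^bsub>G\<^esub> g) x) = x"
  using assms by (simp_all flip: act_mult add: act_one)

text \<open>\<open>G\<close> permutes the factors of \<open>K\<close> as it permutes the arrows; the
  inverse makes this a left action. Both restrictions are there because elements of \<open>K\<close>
  and of \<open>AutoGroup K\<close> are extensional functions.\<close>

definition \<phi> :: "'g \<Rightarrow> ('x \<Rightarrow> 'k \<times> 'k) \<Rightarrow> 'x \<Rightarrow> 'k \<times> 'k"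
  where "\<phi> g = (\<lambda>\<kappa>\<in>carrier K. \<lambda>e\<in>A. \<kappa> (act (inv\<^bsub>G\<^esub> g) e))"

lemma \<phi>_closed: "g \<in> carrier G \<Longrightarrow> \<kappa> \<in> carrier K \<Longrightarrow> \<phi> g \<kappa> \<in> carrier K"
  by (auto simp: \<phi>_def product_group_def act_A)

lemma \<phi>_apply: "\<kappa> \<in> carrier K \<Longrightarrow> e \<in> A \<Longrightarrow> \<phi> g \<kappa> e = \<kappa> (act (inv\<^bsub>G\<^esub> g) e)"
  by (simp add: \<phi>_def)

lemma \<phi>_act: "g \<in> carrier G \<Longrightarrow> \<kappa> \<in> carrier K \<Longrightarrow> e \<in> A \<Longrightarrow> \<phi> g \<kappa> (act g e) = \<kappa> e"
  by (simp add: \<phi>_def act_A act_inv)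

lemma K_eqI:
  assumes "\<kappa> \<in> carrier K" "\<kappa>' \<in> carrier K" "\<And>e. e \<in> A \<Longrightarrow> \<kappa> e = \<kappa>' e"
  shows "\<kappa> = \<kappa>'"
  using assms by (auto simp: product_group_def intro: PiE_ext)

lemma K_mult_apply: "e \<in> A \<Longrightarrow> (\<kappa> \<otimes>\<^bsub>K\<^esub> \<kappa>') e = \<kappa> e \<otimes>\<^bsub>affine_group R\<^esub> \<kappa>' e"
  by (simp add: product_group_def)

lemma \<phi>_mult:
  assumes "g \<in> carrier G" "h \<in> carrier G" "\<kappa> \<in> carrier K"
  shows "\<phi> (g \<otimes>\<^bsub>G\<^esub> h) \<kappa> = \<phi> g (\<phi> h \<kappa>)"
  by (rule K_eqI) (simp_all add: assms \<phi>_closed \<phi>_apply act_A G.inv_mult_group act_mult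
      del: carrier_product_group)

lemma \<phi>_hom: "\<phi> \<in> hom G (AutoGroup K)"
proof -
  have Bij: "\<phi> g \<in> Bij (carrier K)" if g: "g \<in> carrier G" for g
  proof -
    have one: "\<phi> \<one>\<^bsub>G\<^esub> \<kappa> = \<kappa>" if "\<kappa> \<in> carrier K" for \<kappa>
      by (rule K_eqI) (simp_all add: that \<phi>_closed \<phi>_apply act_one del: carrier_product_group)
    have "bij_betw (\<phi> g) (carrier K) (carrier K)"
      by (rule bij_betw_byWitness[where f' = "\<phi> (inv\<^bsub>G\<^esub> g)"])
        (auto simp: g \<phi>_closed one simp flip: \<phi>_mult simp del: carrier_product_group)
    then show ?thesis by (simp add: Bij_def \<phi>_def)
  qed
  have "\<phi> g \<in> hom K K" if g: "g \<in> carrier G" for g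
  proof (rule homI)
    fix \<kappa> \<kappa>' assume "\<kappa> \<in> carrier K" "\<kappa>' \<in> carrier K"
    then show "\<phi> g (\<kappa> \<otimes>\<^bsub>K\<^esub> \<kappa>') = \<phi> g \<kappa> \<otimes>\<^bsub>K\<^esub> \<phi> g \<kappa>'"
      by (intro K_eqI) (simp_all add: g \<phi>_closed \<phi>_apply act_A K_mult_apply
          del: carrier_product_group mult_product_group)
  qed (simp add: g \<phi>_closed del: carrier_product_group)
  with Bij have auto: "\<phi> g \<in> auto K" if "g \<in> carrier G" for g
    using that by (simp add: auto_def)
  show ?thesis
  proof (rule homI)
    fix g h assume gh: "g \<in> carrier G" "h \<in> carrier G"
    have "\<phi> (g \<otimes>\<^bsub>G\<^esub> h) = compose (carrier K) (\<phi> g) (\<phi> h)"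
      by (rule extensionalityI[where A = "carrier K"])
        (simp_all add: \<phi>_mult gh compose_eq, simp add: \<phi>_def)
    then show "\<phi> (g \<otimes>\<^bsub>G\<^esub> h) = \<phi> g \<otimes>\<^bsub>AutoGroup K\<^esub> \<phi> h"
      using Bij gh by (simp add: AutoGroup_def BijGroup_def)
  qed (simp add: AutoGroup_def auto)
qed

text \<open>
  The second coordinate enters inverted, since \<open>(a, u) \<otimes> (b, v) = (a + u b, u v)\<close> in the affine group.
\<close>

definition arrow_image :: "'k \<times> 'k \<Rightarrow> 'x \<Rightarrow> 'x \<Rightarrow> 'k"
  where "arrow_image z e = inv (snd z) \<odot>\<^bsub>C\<^esub>
    (\<delta> e \<oplus>\<^bsub>C\<^esub> fst z \<odot>\<^bsub>C\<^esub> (\<delta> (s e) \<ominus>\<^bsub>C\<^esub> \<delta> (t e)))"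

text \<open>The basis is first moved by \<open>g\<close> and then modified by
  \<open>\<kappa>\<close>, so the parameter is read at the image arrow \<open>act g x\<close>. This
  order reflects the factorization \<open>(\<kappa>, g) = (\<kappa>, 1) (1, g)\<close> in the
  semidirect product.\<close>

definition \<Phi> :: "('x \<Rightarrow> 'k \<times> 'k) \<times> 'g \<Rightarrow> ('x \<Rightarrow> 'k) \<Rightarrow> 'x \<Rightarrow> 'k"
  where "\<Phi> = (\<lambda>(\<kappa>, g). restrict (free_extension R C
    (\<lambda>x. if x \<in> V then \<delta> (act g x) else arrow_image (\<kappa> (act g x)) (act g x))) (carrier C))"

section \<open>The maps \<open>\<Phi> (\<kappa>, g)\<close> respect the coalgebra structure\<close>

lemma arrow_image_closed: "z \<in> carrier (affine_group R) \<Longrightarrow> e \<in> A \<Longrightarrow> arrow_image z e \<in> carrier C"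
  by (auto simp: arrow_image_def affine_group_simps \<delta>_closed source target)

context
  fixes \<kappa> g assumes \<kappa>: "\<kappa> \<in> carrier K" and g: "g \<in> carrier G"
begin

lemma \<Phi>_linear: "\<Phi> (\<kappa>, g) \<in> linear_maps R C C"
proof -
  have "free_extension R C
    (\<lambda>x. if x \<in> V then \<delta> (act g x) else arrow_image (\<kappa> (act g x)) (act g x)) \<in> linear_maps R C C"
    using \<kappa> g disjoint
    by (intro extension_C module_C) (auto simp: \<delta>_closed act_V act_A arrow_image_closed K_mem)
  then show ?thesis by (simp add: \<Phi>_def linear_maps_def Pi_iff)
qed

lemma \<Phi>_V: "x \<in> V \<Longrightarrow> \<Phi> (\<kappa>, g) (\<delta> x) = \<delta> (act g x)"
  using \<kappa> g disjoint unfolding \<Phi>_def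
  by (simp add: \<delta>_closed, subst extension_C(2)[OF module_C])
    (auto simp: \<delta>_closed act_V act_A arrow_image_closed K_mem)

lemma \<Phi>_A: "x \<in> A \<Longrightarrow> \<Phi> (\<kappa>, g) (\<delta> x) = arrow_image (\<kappa> (act g x)) (act g x)"
  using \<kappa> g disjoint unfolding \<Phi>_def
  by (simp add: \<delta>_closed, subst extension_C(3)[OF module_C])
    (auto simp: \<delta>_closed act_V act_A arrow_image_closed K_mem)

lemma \<Phi>_comult:
  assumes "c \<in> carrier C"
  shows "comult C (\<Phi> (\<kappa>, g) c) = tensor_map R C C (\<Phi> (\<kappa>, g)) (\<Phi> (\<kappa>, g)) (comult C c)"
proof (rule C_eqI[OF module_T _ _ _ _ assms])
  let ?T = "tensor_module R C C" and ?f = "\<Phi> (\<kappa>, g)"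
  note tl = tensor_map_linear[OF module_C module_C module_C module_C \<Phi>_linear \<Phi>_linear]
    and tp = tensor_map_pure[OF module_C module_C module_C module_C \<Phi>_linear \<Phi>_linear]
  show "(\<lambda>c. comult C (?f c)) \<in> linear_maps R C ?T"
    by (rule linear_maps_compose[OF \<Phi>_linear comult_linear])
  show "(\<lambda>c. tensor_map R C C ?f ?f (comult C c)) \<in> linear_maps R C ?T"
    by (rule linear_maps_compose[OF comult_linear tl])
  show "comult C (?f (\<delta> x)) = tensor_map R C C ?f ?f (comult C (\<delta> x))" if "x \<in> V" for x
    using that g by (simp add: \<Phi>_V comult_V act_V tp \<delta>_closed)
  show "comult C (?f (\<delta> x)) = tensor_map R C C ?f ?f (comult C (\<delta> x))" if x: "x \<in> A" for x
  proof -
    let ?e = "act g x"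
    let ?p = "s ?e" and ?q = "t ?e" and ?a = "fst (\<kappa> ?e)" and ?u = "inv (snd (\<kappa> ?e))"
    have e: "?e \<in> A" using g x by (rule act_A)
    have a: "?a \<in> carrier R" and u: "?u \<in> carrier R" using K_coeffs[OF \<kappa> e] by auto
    note cl = \<delta>_closed source[OF e] target[OF e] e
    have pl: "(\<lambda>c. pure (\<delta> ?p) c) \<in> linear_maps R C ?T" "(\<lambda>c. pure c (\<delta> ?q)) \<in> linear_maps R C ?T"
      by (rule linear_mapsI; simp add: pure_bilinear cl)+
    note min = linear_maps_minus[OF module_C module_T]
    let ?S = "pure (\<delta> ?p) (\<delta> ?p)" and ?M = "pure (\<delta> ?p) (\<delta> ?q)" and ?Q = "pure (\<delta> ?q) (\<delta> ?q)"
      and ?E = "pure (\<delta> ?p) (\<delta> ?e)" and ?F = "pure (\<delta> ?e) (\<delta> ?q)"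
    have T: "?S \<in> carrier ?T" "?M \<in> carrier ?T" "?Q \<in> carrier ?T" "?E \<in> carrier ?T" "?F \<in> carrier ?T"
      by (simp_all add: pure_bilinear cl)
    \<comment> \<open>Inserting the mixed tensor \<open>p \<otimes> q\<close> gives \<open>p
      \<otimes> p - q \<otimes> q = p \<otimes> (p - q) + (p - q) \<otimes> q\<close>. So
      \<open>p - q\<close> obeys the same comultiplication rule as an arrow from \<open>p\<close> to
      \<open>q\<close> and may be added to it.\<close>
    have "?S \<ominus>\<^bsub>?T\<^esub> ?Q = (?S \<ominus>\<^bsub>?T\<^esub> ?M) \<oplus>\<^bsub>?T\<^esub> (?M \<ominus>\<^bsub>?T\<^esub> ?Q)"
      using T by (simp add: a_minus_def T.a_assoc T.r_neg1)
    then have SQ: "?a \<odot>\<^bsub>?T\<^esub> (?S \<ominus>\<^bsub>?T\<^esub> ?Q) = ?a \<odot>\<^bsub>?T\<^esub> (?S \<ominus>\<^bsub>?T\<^esub> ?M) \<oplus>\<^bsub>?T\<^esub> ?a \<odot>\<^bsub>?T\<^esub> (?M \<ominus>\<^bsub>?T\<^esub> ?Q)"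
      using T a by (simp add: T.smult_r_distr)
    have "comult C (?f (\<delta> x)) = ?u \<odot>\<^bsub>?T\<^esub> ((?E \<oplus>\<^bsub>?T\<^esub> ?F) \<oplus>\<^bsub>?T\<^esub> ?a \<odot>\<^bsub>?T\<^esub> (?S \<ominus>\<^bsub>?T\<^esub> ?Q))"
      using x e a u cl
      by (simp add: \<Phi>_A arrow_image_def linear_mapsD[OF comult_linear] min[OF comult_linear] comult_V comult_A)
    also have "\<dots> = ?u \<odot>\<^bsub>?T\<^esub> (?E \<oplus>\<^bsub>?T\<^esub> ?a \<odot>\<^bsub>?T\<^esub> (?S \<ominus>\<^bsub>?T\<^esub> ?M))
        \<oplus>\<^bsub>?T\<^esub> ?u \<odot>\<^bsub>?T\<^esub> (?F \<oplus>\<^bsub>?T\<^esub> ?a \<odot>\<^bsub>?T\<^esub> (?M \<ominus>\<^bsub>?T\<^esub> ?Q))"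
      unfolding SQ using T a u by (simp flip: T.smult_r_distr add: T.a_ac)
    also have "\<dots> = pure (\<delta> ?p) (arrow_image (\<kappa> ?e) ?e) \<oplus>\<^bsub>?T\<^esub> pure (arrow_image (\<kappa> ?e) ?e) (\<delta> ?q)"
      using a u cl by (simp add: arrow_image_def linear_mapsD[OF pl(1)] linear_mapsD[OF pl(2)] min[OF pl(1)] min[OF pl(2)])
    also have "\<dots> = tensor_map R C C ?f ?f (comult C (\<delta> x))"
      using x source[OF x] target[OF x] g
      by (simp add: comult_A linear_mapsD[OF tl] tp pure_bilinear \<delta>_closed \<Phi>_V \<Phi>_A act_source act_target)
    finally show ?thesis .
  qed
qed

lemma \<Phi>_counit:
  assumes "c \<in> carrier C"
  shows "counit C (\<Phi> (\<kappa>, g) c) = counit C c"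
proof (rule C_eqI[OF module_k linear_maps_compose[OF \<Phi>_linear counit_linear] counit_linear _ _ assms])
  show "counit C (\<Phi> (\<kappa>, g) (\<delta> x)) = counit C (\<delta> x)" if "x \<in> V" for x
    using that g by (simp add: \<Phi>_V counit_V act_V)
  show "counit C (\<Phi> (\<kappa>, g) (\<delta> x)) = counit C (\<delta> x)" if x: "x \<in> A" for x
  proof -
    let ?e = "act g x"
    have e: "?e \<in> A" using g x by (rule act_A)
    have "counit C (\<delta> (s ?e) \<ominus>\<^bsub>C\<^esub> \<delta> (t ?e)) = \<zero>"
      using e by (simp add: linear_maps_minus[OF module_C module_k counit_linear] \<delta>_closed source target counit_V)
        (simp add: k_simps a_minus_def k.r_neg[unfolded k_simps])
    then show ?thesis
      using e x K_coeffs[OF \<kappa> e]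
      by (simp add: \<Phi>_A arrow_image_def linear_mapsD[OF counit_linear] \<delta>_closed source target counit_A k_simps)
  qed
qed

end

text \<open>With \<open>d = s e - t e\<close>, \<open>z = (a, u)\<close> and
  \<open>z' = (b, v)\<close> this is
  \<open>inv v (inv u (e + a d) + b d) = inv (u v) (e + (a + u b) d)\<close>: pulling out
  \<open>inv u\<close> turns \<open>b\<close> into \<open>u b\<close>, which is the affine
  multiplication. The left side is the image of \<open>arrow_image z' e\<close> under a linear map
  that sends \<open>e\<close> to \<open>arrow_image z e\<close> and fixes both ends of
  \<open>e\<close>.\<close>

lemma arrow_image_compose:
  assumes z: "z \<in> carrier (affine_group R)" "z' \<in> carrier (affine_group R)" and e: "e \<in> A"
  shows "inv (snd z') \<odot>\<^bsub>C\<^esub> (arrow_image z e \<oplus>\<^bsub>C\<^esub> fst z' \<odot>\<^bsub>C\<^esub> (\<delta> (s e) \<ominus>\<^bsub>C\<^esub> \<delta> (t e)))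
    = arrow_image (z \<otimes>\<^bsub>affine_group R\<^esub> z') e"
proof -
  obtain a u b v where zz: "z = (a, u)" "z' = (b, v)" "a \<in> carrier R" "b \<in> carrier R" "u \<in> Units R" "v \<in> Units R"
    using z by (auto simp: affine_group_simps)
  define d where "d = \<delta> (s e) \<ominus>\<^bsub>C\<^esub> \<delta> (t e)"
  have cl: "d \<in> carrier C" "\<delta> e \<in> carrier C" using e by (simp_all add: d_def \<delta>_closed source target)
  have "b \<odot>\<^bsub>C\<^esub> d = inv u \<odot>\<^bsub>C\<^esub> ((u \<otimes> b) \<odot>\<^bsub>C\<^esub> d)"
    using zz cl by (simp add: Units_closed m_assoc[symmetric] flip: C.smult_assoc1)
  then have "arrow_image z e \<oplus>\<^bsub>C\<^esub> b \<odot>\<^bsub>C\<^esub> d = inv u \<odot>\<^bsub>C\<^esub> (\<delta> e \<oplus>\<^bsub>C\<^esub> (a \<oplus> u \<otimes> b) \<odot>\<^bsub>C\<^esub> d)"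
    using zz cl by (simp add: arrow_image_def d_def[symmetric] Units_closed C.smult_l_distr C.a_assoc
        flip: C.smult_r_distr)
  moreover have "inv (u \<otimes> v) = inv v \<otimes> inv u"
  proof (rule comm_inv_char)
    have "u \<otimes> v \<otimes> (inv v \<otimes> inv u) = u \<otimes> (v \<otimes> inv v) \<otimes> inv u"
      using zz by (simp add: m_assoc Units_closed del: Units_r_inv)
    then show "u \<otimes> v \<otimes> (inv v \<otimes> inv u) = \<one>" using zz by (simp add: Units_closed)
  qed (use zz in \<open>simp_all add: Units_closed\<close>)
  ultimately show ?thesis
    using zz cl by (simp add: affine_group_simps arrow_image_def d_def[symmetric] Units_closed C.smult_assoc1)
qed

section \<open>The isomorphism from the semidirect product to the automorphism group\<close>

abbreviation (input) "S \<equiv> semidirect_product K G \<phi>"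

lemma S_simps:
  "carrier S = carrier K \<times> carrier G"
  "(\<kappa>, g) \<otimes>\<^bsub>S\<^esub> (\<kappa>', g') = (\<kappa> \<otimes>\<^bsub>K\<^esub> \<phi> g \<kappa>', g \<otimes>\<^bsub>G\<^esub> g')"
  "\<one>\<^bsub>S\<^esub> = (\<one>\<^bsub>K\<^esub>, \<one>\<^bsub>G\<^esub>)"
  by (simp_all add: semidirect_product_def)

lemma group_S: "group S"
  by (rule group_semidirect_product[OF group_K G.group_axioms \<phi>_hom])

sublocale S: group S by (rule group_S)

text \<open>On vertices this is the action law. On an arrow \<open>x\<close> the inner map reads
  \<open>\<kappa>'\<close> at \<open>act g' x\<close>, whereas the product reads its parameter at
  \<open>act g (act g' x)\<close>; the shift by \<open>\<phi> g\<close> reconciles the two, and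
  \<open>arrow_image_compose\<close> does the rest.\<close>

lemma \<Phi>_mult:
  assumes p: "p \<in> carrier S" and q: "q \<in> carrier S" and c: "c \<in> carrier C"
  shows "\<Phi> (p \<otimes>\<^bsub>S\<^esub> q) c = \<Phi> p (\<Phi> q c)"
proof -
  obtain \<kappa> g \<kappa>' g' where pq: "p = (\<kappa>, g)" "q = (\<kappa>', g')"
      and \<kappa>: "\<kappa> \<in> carrier K" "\<kappa>' \<in> carrier K" and g: "g \<in> carrier G" "g' \<in> carrier G"
    using p q unfolding S_simps by blast
  have m: "\<kappa> \<otimes>\<^bsub>K\<^esub> \<phi> g \<kappa>' \<in> carrier K" using \<kappa> g \<phi>_closed by blast
  have gg: "g \<otimes>\<^bsub>G\<^esub> g' \<in> carrier G" using g by simp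
  note lin = \<Phi>_linear[OF \<kappa>(1) g(1)]
  show ?thesis unfolding pq S_simps
  proof (rule C_eqI[OF module_C \<Phi>_linear[OF m gg] linear_maps_compose[OF \<Phi>_linear[OF \<kappa>(2) g(2)] lin] _ _ c])
    show "\<Phi> (\<kappa> \<otimes>\<^bsub>K\<^esub> \<phi> g \<kappa>', g \<otimes>\<^bsub>G\<^esub> g') (\<delta> x) = \<Phi> (\<kappa>, g) (\<Phi> (\<kappa>', g') (\<delta> x))" if "x \<in> V" for x
      using that g by (simp only: \<Phi>_V[OF m gg] \<Phi>_V[OF \<kappa>(2) g(2)] \<Phi>_V[OF \<kappa>(1) g(1)] act_V act_mult UnI1)
    show "\<Phi> (\<kappa> \<otimes>\<^bsub>K\<^esub> \<phi> g \<kappa>', g \<otimes>\<^bsub>G\<^esub> g') (\<delta> x) = \<Phi> (\<kappa>, g) (\<Phi> (\<kappa>', g') (\<delta> x))" if x: "x \<in> A" for x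
    proof -
      let ?y = "act g' x"
      let ?e = "act g ?y" and ?z = "\<kappa>' ?y"
      have y: "?y \<in> A" and e: "?e \<in> A" using x g by (simp_all add: act_A)
      have z: "fst ?z \<in> carrier R" "snd ?z \<in> Units R" using K_coeffs[OF \<kappa>(2) y] by auto
      have "\<Phi> (\<kappa>, g) (arrow_image ?z ?y) = inv (snd ?z) \<odot>\<^bsub>C\<^esub>
          (arrow_image (\<kappa> ?e) ?e \<oplus>\<^bsub>C\<^esub> fst ?z \<odot>\<^bsub>C\<^esub> (\<delta> (s ?e) \<ominus>\<^bsub>C\<^esub> \<delta> (t ?e)))"
        using y z g(1) source[OF y] target[OF y]
        by (simp add: arrow_image_def[of ?z] linear_mapsD[OF lin] linear_maps_minus[OF module_C module_C lin]
            \<delta>_closed \<Phi>_V[OF \<kappa>(1) g(1)] \<Phi>_A[OF \<kappa>(1) g(1)] act_source act_target)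
      also have "\<dots> = arrow_image (\<kappa> ?e \<otimes>\<^bsub>affine_group R\<^esub> ?z) ?e"
        by (rule arrow_image_compose[OF K_mem[OF \<kappa>(1) e] K_mem[OF \<kappa>(2) y] e])
      finally show ?thesis
        using x g y e
        by (simp only: \<Phi>_A[OF m gg] \<Phi>_A[OF \<kappa>(2) g(2)] act_mult UnI2 K_mult_apply \<phi>_act[OF g(1) \<kappa>(2)])
    qed
  qed
qed

lemma \<Phi>_one: "c \<in> carrier C \<Longrightarrow> \<Phi> \<one>\<^bsub>S\<^esub> c = c"
  unfolding S_simps
proof (rule C_eqI[OF module_C \<Phi>_linear[OF K.one_closed G.one_closed] linear_maps_id])
  show "\<Phi> (\<one>\<^bsub>K\<^esub>, \<one>\<^bsub>G\<^esub>) (\<delta> x) = \<delta> x" if "x \<in> V" for x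
    using that by (simp only: \<Phi>_V[OF K.one_closed G.one_closed] act_one UnI1)
  show "\<Phi> (\<one>\<^bsub>K\<^esub>, \<one>\<^bsub>G\<^esub>) (\<delta> x) = \<delta> x" if x: "x \<in> A" for x
  proof -
    have "\<one>\<^bsub>K\<^esub> x = (\<zero>, \<one>)" using x by (simp add: product_group_def affine_group_simps)
    then have "\<Phi> (\<one>\<^bsub>K\<^esub>, \<one>\<^bsub>G\<^esub>) (\<delta> x) = arrow_image (\<zero>, \<one>) x"
      using x by (simp only: \<Phi>_A[OF K.one_closed G.one_closed] act_one UnI2)
    also have "\<dots> = \<delta> x" using x by (simp add: arrow_image_def \<delta>_closed source target)
    finally show ?thesis .
  qed
qed

text \<open>Bijectivity follows from multiplicativity: \<open>\<Phi>\<close> of the inverse element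
  of \<open>S\<close> is an inverse map.\<close>

lemma \<Phi>_closed:
  assumes "p \<in> carrier S"
  shows "\<Phi> p \<in> coalgebra_autos R C"
proof -
  have lin: "\<Phi> q \<in> linear_maps R C C" if "q \<in> carrier S" for q
    using that \<Phi>_linear by (cases q) (simp only: S_simps mem_Times_iff fst_conv snd_conv)
  have cl: "\<Phi> q ` carrier C \<subseteq> carrier C" if "q \<in> carrier S" for q
    using linear_mapsD(1)[OF lin[OF that]] by blast
  have inv: "\<Phi> (inv\<^bsub>S\<^esub> q) (\<Phi> q c) = c" if "q \<in> carrier S" "c \<in> carrier C" for q c
    using that \<Phi>_mult[of "inv\<^bsub>S\<^esub> q" q c] \<Phi>_one by simp
  have "bij_betw (\<Phi> p) (carrier C) (carrier C)"
  proof (rule bij_betw_byWitness[where f' = "\<Phi> (inv\<^bsub>S\<^esub> p)"])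
    show "\<forall>c\<in>carrier C. \<Phi> p (\<Phi> (inv\<^bsub>S\<^esub> p) c) = c"
      using inv[of "inv\<^bsub>S\<^esub> p"] assms by simp
  qed (use assms inv cl in simp_all)
  moreover have "\<Phi> p \<in> extensional (carrier C)" by (simp add: \<Phi>_def split: prod.split)
  ultimately have "\<Phi> p \<in> Bij (carrier C)" by (simp add: Bij_def)
  moreover obtain \<kappa> g where "p = (\<kappa>, g)" "\<kappa> \<in> carrier K" "g \<in> carrier G"
    using assms unfolding S_simps by blast
  ultimately show ?thesis
    using lin[OF assms] \<Phi>_comult \<Phi>_counit by (simp add: coalgebra_autos_def)
qed

text \<open>The vertex permutation of \<open>f\<close> comes from some \<open>g\<close> by
  \<open>act_full\<close>. The parameter at an arrow \<open>e\<close> is then read from the image of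
  the arrow that \<open>g\<close> carries to \<open>e\<close>.\<close>

lemma \<Phi>_surj:
  assumes f: "f \<in> coalgebra_autos R C"
  obtains p where "p \<in> carrier S" "f = \<Phi> p"
proof -
  obtain \<sigma> where \<sigma>: "bij_betw \<sigma> V V" "\<And>v. v \<in> V \<Longrightarrow> f (\<delta> v) = \<delta> (\<sigma> v)"
    "\<And>v w. v \<in> V \<Longrightarrow> w \<in> V \<Longrightarrow>
      (\<exists>e\<in>A. s e = v \<and> t e = w) \<longleftrightarrow> (\<exists>e\<in>A. s e = \<sigma> v \<and> t e = \<sigma> w)"
    using auto_vertices[OF f] by blast
  obtain g where g: "g \<in> carrier G" "\<And>v. v \<in> V \<Longrightarrow> \<sigma> v = act g v"
    using act_full[OF \<sigma>(1,3)] by blast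
  have fV: "f (\<delta> v) = \<delta> (act g v)" if "v \<in> V" for v using \<sigma>(2) g(2) that by simp
  have "\<exists>z\<in>carrier (affine_group R). f (\<delta> (act (inv\<^bsub>G\<^esub> g) e)) = arrow_image z e" if e: "e \<in> A" for e
  proof -
    let ?x = "act (inv\<^bsub>G\<^esub> g) e"
    have x: "?x \<in> A" "act g ?x = e" using e g(1) by (simp_all add: act_A act_inv)
    have st: "act g (s ?x) = s e" "act g (t ?x) = t e"
      using act_source[OF g(1) x(1)] act_target[OF g(1) x(1)] x(2) by simp_all
    have "f (\<delta> (s ?x)) = \<delta> (s e)" "f (\<delta> (t ?x)) = \<delta> (t e)"
      using fV[OF source[OF x(1)]] fV[OF target[OF x(1)]] st by simp_all
    from auto_arrow[OF f x(1) source[OF e] target[OF e] this]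
    obtain e' u a where e': "e' \<in> A" "s e' = s e" "t e' = t e" "u \<in> Units R" "a \<in> carrier R"
      "f (\<delta> ?x) = inv u \<odot>\<^bsub>C\<^esub> (\<delta> e' \<oplus>\<^bsub>C\<^esub> a \<odot>\<^bsub>C\<^esub> (\<delta> (s e) \<ominus>\<^bsub>C\<^esub> \<delta> (t e)))"
      by blast
    \<comment> \<open>Both arrows have the same ends, and there are no parallel arrows.\<close>
    have "e' = e" using simple e' e by blast
    then have "f (\<delta> ?x) = arrow_image (a, u) e" unfolding arrow_image_def using e'(6) by simp
    then show ?thesis using e'(4,5) by (intro bexI[of _ "(a, u)"]) (simp_all add: affine_group_simps)
  qed
  then obtain \<kappa>0 where \<kappa>0: "\<And>e. e \<in> A \<Longrightarrow> \<kappa>0 e \<in> carrier (affine_group R)"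
    "\<And>e. e \<in> A \<Longrightarrow> f (\<delta> (act (inv\<^bsub>G\<^esub> g) e)) = arrow_image (\<kappa>0 e) e"
    by metis
  define \<kappa> where "\<kappa> = restrict \<kappa>0 A"
  have \<kappa>: "\<kappa> \<in> carrier K" using \<kappa>0(1) by (auto simp: \<kappa>_def product_group_def)
  have eq: "f c = \<Phi> (\<kappa>, g) c" if "c \<in> carrier C" for c
  proof (rule C_eqI[OF module_C coalgebra_autosD(1)[OF f] \<Phi>_linear[OF \<kappa> g(1)] _ _ that])
    show "f (\<delta> x) = \<Phi> (\<kappa>, g) (\<delta> x)" if "x \<in> V" for x
      using that by (simp only: fV \<Phi>_V[OF \<kappa> g(1)])
    show "f (\<delta> x) = \<Phi> (\<kappa>, g) (\<delta> x)" if "x \<in> A" for x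
    proof -
      have "act g x \<in> A" "act (inv\<^bsub>G\<^esub> g) (act g x) = x" using that g(1) by (simp_all add: act_A act_inv)
      then show ?thesis using \<kappa>0(2)[of "act g x"] that by (simp only: \<Phi>_A[OF \<kappa> g(1)]) (simp add: \<kappa>_def)
    qed
  qed
  have p: "(\<kappa>, g) \<in> carrier S" using \<kappa> g(1) by (simp only: S_simps mem_Times_iff fst_conv snd_conv)
  have "f = \<Phi> (\<kappa>, g)"
    using coalgebra_autosD(3)[OF f] coalgebra_autosD(3)[OF \<Phi>_closed[OF p]] eq by (rule extensionalityI)
  then show ?thesis using that p by blast
qed

text \<open>For \<open>z = (a, u)\<close> the coefficients at \<open>e\<close> and at
  \<open>s e\<close> are \<open>inv u\<close> and \<open>inv u \<otimes> a\<close>, from which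
  \<open>u\<close> and then \<open>a\<close> are recovered.\<close>

lemma arrow_image_inj:
  assumes z: "z \<in> carrier (affine_group R)" "z' \<in> carrier (affine_group R)" and e: "e \<in> A"
    and eq: "arrow_image z e = arrow_image z' e"
  shows "z = z'"
proof -
  have val: "arrow_image z e e = inv (snd z)" "arrow_image z e (s e) = inv (snd z) \<otimes> fst z"
    if "z \<in> carrier (affine_group R)" for z
  proof -
    have z: "fst z \<in> carrier R" "inv (snd z) \<in> carrier R" using that by (auto simp: affine_group_simps)
    have ne: "s e \<noteq> e" "t e \<noteq> e" "s e \<noteq> t e" using e source target disjoint no_loop by metis+
    have d: "(\<delta> (s e) \<ominus>\<^bsub>C\<^esub> \<delta> (t e)) e = \<zero>" "(\<delta> (s e) \<ominus>\<^bsub>C\<^esub> \<delta> (t e)) (s e) = \<one>"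
      using ne e by (simp_all add: minus_C \<delta>_closed source target)
        (simp_all add: free_generator_def a_minus_def)
    have g: "\<delta> e e = \<one>" "\<delta> e (s e) = \<zero>" using ne by (simp_all add: free_generator_def)
    show "arrow_image z e e = inv (snd z)" "arrow_image z e (s e) = inv (snd z) \<otimes> fst z"
      unfolding arrow_image_def using z by (simp_all add: ops_C(2,3) d g)
  qed
  have u: "snd z \<in> Units R" "snd z' \<in> Units R" "fst z \<in> carrier R" "fst z' \<in> carrier R"
    using z by (auto simp: affine_group_simps)
  have "inv (snd z) = inv (snd z')" using val(1)[OF z(1)] val(1)[OF z(2)] eq by simp
  then have 1: "snd z = snd z'" using u by (metis Units_inv_inv)
  then have "inv (snd z) \<otimes> fst z = inv (snd z) \<otimes> fst z'"
    using val(2)[OF z(1)] val(2)[OF z(2)] eq by simp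
  then have "fst z = fst z'" using u by (simp add: Units_l_cancel)
  with 1 show ?thesis by (simp add: prod_eq_iff)
qed

lemma \<Phi>_inj: "inj_on \<Phi> (carrier S)"
proof (rule inj_onI)
  fix p q assume p: "p \<in> carrier S" and q: "q \<in> carrier S" and eq: "\<Phi> p = \<Phi> q"
  obtain \<kappa> g \<kappa>' g' where pq: "p = (\<kappa>, g)" "q = (\<kappa>', g')"
      and \<kappa>: "\<kappa> \<in> carrier K" "\<kappa>' \<in> carrier K" and g: "g \<in> carrier G" "g' \<in> carrier G"
    using p q unfolding S_simps by blast
  have "act g v = act g' v" if "v \<in> V" for v
    using \<Phi>_V[OF \<kappa>(1) g(1) that] \<Phi>_V[OF \<kappa>(2) g(2) that] eq free_generator_inj unfolding pq by metis
  then have gg: "g = g'" by (rule act_faithful[OF g])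
  have "\<kappa> e = \<kappa>' e" if e: "e \<in> A" for e
  proof -
    let ?x = "act (inv\<^bsub>G\<^esub> g) e"
    have x: "?x \<in> A" "act g ?x = e" using e g(1) by (simp_all add: act_A act_inv)
    have "arrow_image (\<kappa> e) e = arrow_image (\<kappa>' e) e"
      using \<Phi>_A[OF \<kappa>(1) g(1) x(1)] \<Phi>_A[OF \<kappa>(2) g(2), of ?x] x eq unfolding pq gg[symmetric] by simp
    then show ?thesis by (rule arrow_image_inj[OF K_mem[OF \<kappa>(1) e] K_mem[OF \<kappa>(2) e] e])
  qed
  then show "p = q" unfolding pq gg using K_eqI[OF \<kappa>] by blast
qed

lemma \<Phi>_iso: "\<Phi> \<in> iso S (coalgebra_AutoGroup R C)"
proof (rule isoI)
  have car: "carrier (coalgebra_AutoGroup R C) = coalgebra_autos R C"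
    by (simp add: coalgebra_AutoGroup_def)
  show "\<Phi> \<in> hom S (coalgebra_AutoGroup R C)"
  proof (rule homI)
    show "\<Phi> p \<in> carrier (coalgebra_AutoGroup R C)" if "p \<in> carrier S" for p
      using \<Phi>_closed[OF that] by (simp only: car)
    fix p q assume p: "p \<in> carrier S" and q: "q \<in> carrier S"
    note autos = \<Phi>_closed[OF p] \<Phi>_closed[OF q]
    have "\<Phi> (p \<otimes>\<^bsub>S\<^esub> q) = compose (carrier C) (\<Phi> p) (\<Phi> q)"
      by (rule extensionalityI[OF coalgebra_autosD(3)[OF \<Phi>_closed[OF S.m_closed[OF p q]]]])
        (simp_all add: \<Phi>_mult[OF p q] compose_eq)
    also have "\<dots> = \<Phi> p \<otimes>\<^bsub>coalgebra_AutoGroup R C\<^esub> \<Phi> q"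
      using autos by (simp add: coalgebra_AutoGroup_def BijGroup_def coalgebra_autos_def)
    finally show "\<Phi> (p \<otimes>\<^bsub>S\<^esub> q) = \<Phi> p \<otimes>\<^bsub>coalgebra_AutoGroup R C\<^esub> \<Phi> q" .
  qed
  show "bij_betw \<Phi> (carrier S) (carrier (coalgebra_AutoGroup R C))"
    unfolding bij_betw_def car using \<Phi>_inj \<Phi>_closed \<Phi>_surj by blast
qed

text \<open>On the grouplikes \<open>\<delta> v\<close> the map \<open>\<Phi> (\<kappa>, g)\<close>
  acts through \<open>act g\<close> alone. So changing \<open>\<kappa>\<close> to the identity does
  not change the restriction, which gives surjectivity onto the image, and injectivity is
  \<open>act_faithful\<close>.\<close>

lemma restriction_iso:
  "(\<lambda>g. grouplike_restriction R C (\<Phi> (\<one>\<^bsub>K\<^esub>, g)))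
    \<in> iso G (BijGroup (grouplikes R C)
      \<lparr>carrier := grouplike_restriction R C ` carrier (coalgebra_AutoGroup R C)\<rparr>)"
proof (rule isoI)
  let ?r = "grouplike_restriction R C" and ?B = "BijGroup (grouplikes R C)"
  let ?f = "\<lambda>g. ?r (\<Phi> (\<one>\<^bsub>K\<^esub>, g))"
  interpret coalgebra R C by (rule coalgebra_C)
  have car: "carrier (coalgebra_AutoGroup R C) = \<Phi> ` carrier S"
    using \<Phi>_iso by (auto simp: iso_def bij_betw_def)
  have S1: "(\<one>\<^bsub>K\<^esub>, g) \<in> carrier S" if "g \<in> carrier G" for g
    using that K.one_closed by (simp only: S_simps mem_Times_iff fst_conv snd_conv)
  have rV: "?r (\<Phi> (\<kappa>, g)) (\<delta> v) = \<delta> (act g v)" if "\<kappa> \<in> carrier K" "g \<in> carrier G" "v \<in> V" for \<kappa> g v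
    using \<Phi>_V[OF that] that(3) by (simp add: grouplike_restriction_def grouplikes_C)
  have \<phi>1: "\<phi> g \<one>\<^bsub>K\<^esub> = \<one>\<^bsub>K\<^esub>" if "g \<in> carrier G" for g
    using AutoGroup_hom_action(1,2)[OF \<phi>_hom that, of "\<one>\<^bsub>K\<^esub>"] K.one_closed
    by (metis K.l_cancel_one' K.l_one)
  show "?f \<in> hom G (?B\<lparr>carrier := ?r ` carrier (coalgebra_AutoGroup R C)\<rparr>)"
  proof (rule homI)
    show "?f g \<in> carrier (?B\<lparr>carrier := ?r ` carrier (coalgebra_AutoGroup R C)\<rparr>)" if "g \<in> carrier G" for g
      using S1[OF that] unfolding car by simp
    fix g h assume g: "g \<in> carrier G" and h: "h \<in> carrier G"
    have "(\<one>\<^bsub>K\<^esub>, g \<otimes>\<^bsub>G\<^esub> h) = (\<one>\<^bsub>K\<^esub>, g) \<otimes>\<^bsub>S\<^esub> (\<one>\<^bsub>K\<^esub>, h)"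
      unfolding S_simps \<phi>1[OF g] K.l_one[OF K.one_closed] ..
    then have "?f (g \<otimes>\<^bsub>G\<^esub> h) = ?r (\<Phi> (\<one>\<^bsub>K\<^esub>, g) \<otimes>\<^bsub>coalgebra_AutoGroup R C\<^esub> \<Phi> (\<one>\<^bsub>K\<^esub>, h))"
      using hom_mult[OF iso_imp_homomorphism[OF \<Phi>_iso] S1[OF g] S1[OF h]] by simp
    also have "\<dots> = ?f g \<otimes>\<^bsub>?B\<^esub> ?f h"
      using hom_mult[OF grouplike_restriction_hom] S1[OF g] S1[OF h] unfolding car by blast
    finally show "?f (g \<otimes>\<^bsub>G\<^esub> h)
        = ?f g \<otimes>\<^bsub>?B\<lparr>carrier := ?r ` carrier (coalgebra_AutoGroup R C)\<rparr>\<^esub> ?f h" by simp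
  qed
  have "inj_on ?f (carrier G)"
  proof (rule inj_onI)
    fix g h assume g: "g \<in> carrier G" and h: "h \<in> carrier G" and eq: "?f g = ?f h"
    have "act g v = act h v" if "v \<in> V" for v
      using rV[OF K.one_closed g that] rV[OF K.one_closed h that] eq free_generator_inj by metis
    then show "g = h" by (rule act_faithful[OF g h])
  qed
  moreover have "?f ` carrier G = ?r ` carrier (coalgebra_AutoGroup R C)"
  proof
    show "?f ` carrier G \<subseteq> ?r ` carrier (coalgebra_AutoGroup R C)" unfolding car using S1 by blast
    show "?r ` carrier (coalgebra_AutoGroup R C) \<subseteq> ?f ` carrier G"
    proof
      fix h assume "h \<in> ?r ` carrier (coalgebra_AutoGroup R C)"
      then obtain \<kappa> g where h: "h = ?r (\<Phi> (\<kappa>, g))" and \<kappa>: "\<kappa> \<in> carrier K" and g: "g \<in> carrier G"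
        unfolding car S_simps by blast
      have "h = ?f g" unfolding h
      proof (rule extensionalityI[where A = "grouplikes R C"])
        fix c assume "c \<in> grouplikes R C"
        then obtain v where "v \<in> V" "c = \<delta> v" unfolding grouplikes_C by blast
        then show "?r (\<Phi> (\<kappa>, g)) c = ?f g c" using rV[OF \<kappa> g] rV[OF K.one_closed g] by simp
      qed (simp_all add: grouplike_restriction_def)
      then show "h \<in> ?f ` carrier G" using g by blast
    qed
  qed
  ultimately show "bij_betw ?f (carrier G) (carrier (?B\<lparr>carrier := ?r ` carrier (coalgebra_AutoGroup R C)\<rparr>))"
    by (simp add: bij_betw_def)
qed

end

section \<open>A quiver with a prescribed automorphism group\<close>

locale wellordered_group = group G for G :: "('g, 'n) monoid_scheme" (structure) +
  fixes less :: "'g \<Rightarrow> 'g \<Rightarrow> bool" (infix "\<lless>" 50)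
  assumes less_total: "x \<noteq> y \<Longrightarrow> x \<lless> y \<or> y \<lless> x"
    and less_wf: "wf {(x, y). x \<lless> y}"
begin

section \<open>Rigidity of well-orders\<close>

lemma less_asym: "x \<lless> y \<Longrightarrow> \<not> y \<lless> x"
  using wf_asym[OF less_wf] by blast

text \<open>If \<open>f g\<close> were below \<open>g\<close>, monotonicity would put
  \<open>f (f g)\<close> below \<open>f g\<close>, so \<open>f g\<close> would be a smaller
  counterexample.\<close>

lemma not_below_strict_mono:
  assumes "\<And>g h. g \<in> A \<Longrightarrow> h \<in> A \<Longrightarrow> g \<lless> h \<Longrightarrow> f g \<lless> f h"
    and "f ` A \<subseteq> A" and "g \<in> A"
  shows "\<not> f g \<lless> g"
  using less_wf assms(3)
proof (induction g rule: wf_induct_rule)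
  case (less g)
  then show ?case using assms(1,2) by blast
qed

section \<open>The directed graph on pairs of group elements and its automorphisms\<close>

definition vertices :: "('g \<times> 'g) set"
  where "vertices = carrier G \<times> carrier G"

text \<open>The last two disjuncts are reversals of each other. The condition
  \<open>g \<noteq> \<one>\<close> keeps their ends in different sets \<open>{x} \<times> G\<close>,
  so they give no loops and never run parallel to the order arrows.\<close>

definition edges :: "(('g \<times> 'g) \<times> ('g \<times> 'g)) set"
  where "edges = {((x, g), (y, h)) | x g y h.
    {x, g, y, h} \<subseteq> carrier G \<and>
    (x = y \<and> g \<lless> h \<or> g \<noteq> \<one> \<and> h = \<one> \<and> y = x \<otimes> g \<or> h \<noteq> \<one> \<and> g = \<one> \<and> x = y \<otimes> h)}"

text \<open>An order arrow is never reversed, because \<open>x = x \<otimes> h\<close> would force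
  \<open>h = \<one>\<close>. The order can thus be recovered from the one-way arrows, and the
  multiplication from the two-way arrows.\<close>

lemma single_edge:
  assumes "x \<in> carrier G" "g \<in> carrier G" "y \<in> carrier G" "h \<in> carrier G"
  shows "((x, g), (y, h)) \<in> edges \<and> ((y, h), (x, g)) \<notin> edges \<longleftrightarrow> x = y \<and> g \<lless> h"
  using assms less_asym[of g h] by (auto simp: edges_def r_cancel_one r_cancel_one')

lemma double_edge:
  assumes "x \<in> carrier G" "g \<in> carrier G" "y \<in> carrier G" "h \<in> carrier G"
  shows "((x, g), (y, h)) \<in> edges \<and> ((y, h), (x, g)) \<in> edges \<longleftrightarrow>
    g \<noteq> \<one> \<and> h = \<one> \<and> y = x \<otimes> g \<or> h \<noteq> \<one> \<and> g = \<one> \<and> x = y \<otimes> h"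
  using assms less_asym[of g h] by (auto simp: edges_def)

lemma edges_irrefl: "(v, v) \<notin> edges"
  using less_asym by (auto simp: edges_def)

text \<open>One-way arrows are preserved, so each \<open>{x} \<times> G\<close> is mapped strictly
  monotonically into a single such set; every \<open>g\<close> is comparable with
  \<open>\<one>\<close>, and a strictly monotone self-map of a well-order moves nothing down.
  Bijectivity is not part of the statement, which is applied to an automorphism and to its inverse
  separately.\<close>

lemma edge_preserving:
  assumes closed: "\<And>v. v \<in> vertices \<Longrightarrow> \<sigma> v \<in> vertices"
    and edge: "\<And>v w. v \<in> vertices \<Longrightarrow> w \<in> vertices \<Longrightarrow> (v, w) \<in> edges \<longleftrightarrow> (\<sigma> v, \<sigma> w) \<in> edges"
    and x: "x \<in> carrier G" and g: "g \<in> carrier G"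
  shows "fst (\<sigma> (x, g)) = fst (\<sigma> (x, \<one>))" and "\<not> snd (\<sigma> (x, g)) \<lless> g"
proof -
  have mono: "fst (\<sigma> (x, g)) = fst (\<sigma> (x, h)) \<and> snd (\<sigma> (x, g)) \<lless> snd (\<sigma> (x, h))"
    if "g \<in> carrier G" "h \<in> carrier G" "g \<lless> h" for g h
  proof -
    have P: "(x, g) \<in> vertices" "(x, h) \<in> vertices" using that x by (simp_all add: vertices_def)
    have "(\<sigma> (x, g), \<sigma> (x, h)) \<in> edges \<and> (\<sigma> (x, h), \<sigma> (x, g)) \<notin> edges"
      using single_edge[OF x that(1) x that(2)] that(3) edge[OF P] edge[OF P(2,1)] by simp
    then show ?thesis
      using closed[OF P(1)] closed[OF P(2)]
        single_edge[of "fst (\<sigma> (x, g))" "snd (\<sigma> (x, g))" "fst (\<sigma> (x, h))" "snd (\<sigma> (x, h))"]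
      by (auto simp: vertices_def mem_Times_iff)
  qed
  show "fst (\<sigma> (x, g)) = fst (\<sigma> (x, \<one>))"
    using mono[OF g one_closed] mono[OF one_closed g] less_total[of g \<one>] by metis
  show "\<not> snd (\<sigma> (x, g)) \<lless> g"
  proof (rule not_below_strict_mono[where A = "carrier G" and f = "\<lambda>g. snd (\<sigma> (x, g))"])
    show "(\<lambda>g. snd (\<sigma> (x, g))) ` carrier G \<subseteq> carrier G"
      using closed x by (force simp: vertices_def)
  qed (use mono g in blast)+
qed

text \<open>Neither \<open>\<sigma>\<close> nor its inverse lowers a second coordinate, so both fix
  it. The two-way arrows then show that the map \<open>f\<close> on first coordinates commutes with
  right multiplication, whence it is left multiplication by \<open>f \<one>\<close>.\<close>

lemma graph_automorphism:
  assumes bij: "bij_betw \<sigma> vertices vertices"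
    and edge: "\<And>v w. v \<in> vertices \<Longrightarrow> w \<in> vertices \<Longrightarrow> (v, w) \<in> edges \<longleftrightarrow> (\<sigma> v, \<sigma> w) \<in> edges"
  obtains a where "a \<in> carrier G"
    "\<And>x g. x \<in> carrier G \<Longrightarrow> g \<in> carrier G \<Longrightarrow> \<sigma> (x, g) = (a \<otimes> x, g)"
proof -
  let ?\<tau> = "inv_into vertices \<sigma>"
  have cl: "\<sigma> v \<in> vertices" "?\<tau> v \<in> vertices" "\<sigma> (?\<tau> v) = v" "?\<tau> (\<sigma> v) = v" if "v \<in> vertices" for v
    using bij that bij_betwE[OF bij] bij_betwE[OF bij_betw_inv_into[OF bij]]
    by (auto simp: bij_betw_inv_into_left bij_betw_inv_into_right)
  have \<sigma>: "fst (\<sigma> (x, g)) = fst (\<sigma> (x, \<one>))" "\<not> snd (\<sigma> (x, g)) \<lless> g"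
    if "x \<in> carrier G" "g \<in> carrier G" for x g
    using edge_preserving[of \<sigma> x g] cl(1) edge that by blast+
  have "(v, w) \<in> edges \<longleftrightarrow> (?\<tau> v, ?\<tau> w) \<in> edges" if "v \<in> vertices" "w \<in> vertices" for v w
    using edge[of "?\<tau> v" "?\<tau> w"] cl that by simp
  then have \<tau>: "\<not> snd (?\<tau> (x, g)) \<lless> g" if "x \<in> carrier G" "g \<in> carrier G" for x g
    using edge_preserving(2)[of ?\<tau> x g] cl(2) that by blast
  define f where "f x = fst (\<sigma> (x, \<one>))" for x
  have f: "f x \<in> carrier G" if "x \<in> carrier G" for x
    using cl(1)[of "(x, \<one>)"] that by (auto simp: f_def vertices_def mem_Times_iff)
  have \<sigma>_eq: "\<sigma> (x, g) = (f x, g)" if x: "x \<in> carrier G" and g: "g \<in> carrier G" for x g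
  proof -
    have v: "(x, g) \<in> vertices" using x g by (simp add: vertices_def)
    obtain h where h: "\<sigma> (x, g) = (f x, h)" "h \<in> carrier G"
      using \<sigma>(1)[OF x g] cl(1)[OF v] by (cases "\<sigma> (x, g)") (auto simp: f_def vertices_def)
    have "\<not> h \<lless> g" using \<sigma>(2)[OF x g] h by simp
    \<comment> \<open>The inverse carries \<open>(f x, h)\<close> back to \<open>(x, g)\<close>, so
      \<open>g\<close> below \<open>h\<close> would mean that it moves \<open>h\<close>
      down.\<close>
    moreover have "\<not> g \<lless> h" using \<tau>[OF f[OF x] h(2)] cl(4)[OF v] h by simp
    ultimately have "h = g" using less_total by blast
    with h(1) show ?thesis by simp
  qed
  have mult: "f (x \<otimes> g) = f x \<otimes> g" if x: "x \<in> carrier G" and g: "g \<in> carrier G" for x g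
  proof (cases "g = \<one>")
    case False
    have xg: "x \<otimes> g \<in> carrier G" using x g by simp
    have P: "(x, g) \<in> vertices" "(x \<otimes> g, \<one>) \<in> vertices" using x g by (simp_all add: vertices_def)
    \<comment> \<open>The two-way arrow between \<open>(x, g)\<close> and
      \<open>(x \<otimes> g, \<one>)\<close> is carried to one between the images, whose second
      coordinates are still \<open>g\<close> and \<open>\<one>\<close>.\<close>
    have "((f x, g), (f (x \<otimes> g), \<one>)) \<in> edges \<and> ((f (x \<otimes> g), \<one>), (f x, g)) \<in> edges"
      using double_edge[OF x g xg one_closed] False edge[OF P] edge[OF P(2,1)] \<sigma>_eq[OF x g] \<sigma>_eq[OF xg one_closed]
      by simp
    then show ?thesis using double_edge[OF f[OF x] g f[OF xg] one_closed] by simp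
  qed (simp add: x f)
  have "\<sigma> (x, g) = (f \<one> \<otimes> x, g)" if "x \<in> carrier G" "g \<in> carrier G" for x g
    using \<sigma>_eq[OF that] mult[OF one_closed that(1)] l_one[OF that(1)] by metis
  then show ?thesis by (rule that[OF f[OF one_closed]])
qed

section \<open>Encoding the graph as a quiver with an action of \<open>G\<close>\<close>

fun vertex :: "'g \<times> 'g \<Rightarrow> nat \<times> 'g list"
  where "vertex (x, g) = (0, [x, g])"

text \<open>Vertices and arrows have to share one basis type, and the numerical tag keeps them
  apart. The coordinates of the source precede those of the target, so both ends can be cut out of
  the list.\<close>

fun arrow :: "('g \<times> 'g) \<times> ('g \<times> 'g) \<Rightarrow> nat \<times> 'g list"
  where "arrow ((x, g), (y, h)) = (1, [x, g, y, h])"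

definition arrow_source :: "nat \<times> 'g list \<Rightarrow> nat \<times> 'g list"
  where "arrow_source e = (0, take 2 (snd e))"

definition arrow_target :: "nat \<times> 'g list \<Rightarrow> nat \<times> 'g list"
  where "arrow_target e = (0, drop 2 (snd e))"

text \<open>Only the first coordinate of each pair is multiplied, so a single recursion serves both
  the lists of length 2 for vertices and those of length 4 for arrows.\<close>

fun translate_list :: "'g \<Rightarrow> 'g list \<Rightarrow> 'g list"
  where "translate_list a (x # g # l) = (a \<otimes> x) # g # translate_list a l"
  | "translate_list a l = l"

definition translate :: "'g \<Rightarrow> nat \<times> 'g list \<Rightarrow> nat \<times> 'g list"
  where "translate a = map_prod id (translate_list a)"

lemma arrow_ends: "arrow_source (arrow (v, w)) = vertex v" "arrow_target (arrow (v, w)) = vertex w"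
  by (cases v; cases w; simp add: arrow_source_def arrow_target_def)+

lemma vertex_inj: "vertex v = vertex w \<Longrightarrow> v = w"
  by (cases v; cases w) simp

lemma arrow_between:
  "(\<exists>e\<in>arrow ` edges. arrow_source e = vertex v \<and> arrow_target e = vertex w) \<longleftrightarrow> (v, w) \<in> edges"
proof
  assume "\<exists>e\<in>arrow ` edges. arrow_source e = vertex v \<and> arrow_target e = vertex w"
  then obtain v' w' where "(v', w') \<in> edges" "vertex v' = vertex v" "vertex w' = vertex w"
    by (metis arrow_ends imageE surj_pair)
  then show "(v, w) \<in> edges" using vertex_inj by metis
qed (metis arrow_ends imageI)

text \<open>Left translation leaves second coordinates alone and, by associativity, commutes with
  the right multiplication in the two-way arrows.\<close>

lemma translate_edge:
  assumes "a \<in> carrier G" "((x, g), (y, h)) \<in> edges"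
  shows "((a \<otimes> x, g), (a \<otimes> y, h)) \<in> edges"
  using assms by (auto simp: edges_def m_assoc)

lemma edgeE:
  assumes "e \<in> arrow ` edges"
  obtains x g y h where "e = arrow ((x, g), (y, h))" "((x, g), (y, h)) \<in> edges"
    "x \<in> carrier G" "g \<in> carrier G" "y \<in> carrier G" "h \<in> carrier G"
  using assms by (auto simp: edges_def)

lemma vertexE:
  assumes "v \<in> vertex ` vertices"
  obtains x g where "v = vertex (x, g)" "x \<in> carrier G" "g \<in> carrier G"
  using assms by (auto simp: vertices_def)

lemma quiver_action:
  assumes "field k"
  shows "quiver_action k (vertex ` vertices) (arrow ` edges) arrow_source arrow_target G translate"
proof (intro quiver_action.intro simple_quiver.intro simple_quiver_axioms.intro
    quiver_action_axioms.intro assms group_axioms)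
  let ?V = "vertex ` vertices" and ?A = "arrow ` edges"
  show "x \<notin> ?A" if "x \<in> ?V" for x
    using that by (auto elim!: vertexE edgeE)
  show "arrow_source e \<in> ?V" "arrow_target e \<in> ?V" "arrow_source e \<noteq> arrow_target e" if e: "e \<in> ?A" for e
  proof -
    obtain v w where vw: "e = arrow (v, w)" "(v, w) \<in> edges" "v \<in> vertices" "w \<in> vertices"
      using e by (auto simp: vertices_def elim!: edgeE)
    show "arrow_source e \<in> ?V" "arrow_target e \<in> ?V" using vw by (simp_all only: arrow_ends imageI)
    show "arrow_source e \<noteq> arrow_target e"
      using vw edges_irrefl vertex_inj unfolding vw(1) arrow_ends by blast
  qed
  show "e = e'" if "e \<in> ?A" "e' \<in> ?A" "arrow_source e = arrow_source e'" "arrow_target e = arrow_target e'"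
    for e e'
    using that by (auto elim!: edgeE simp only: arrow_ends dest!: vertex_inj)
  fix a assume a: "a \<in> carrier G"
  show "translate a x \<in> ?V" if "x \<in> ?V" for x
    using that a by (auto simp: translate_def vertices_def image_iff)
  show "translate a e \<in> ?A" "arrow_source (translate a e) = translate a (arrow_source e)"
    "arrow_target (translate a e) = translate a (arrow_target e)" if "e \<in> ?A" for e
    using that a
    by (auto elim!: edgeE simp: translate_def arrow_source_def arrow_target_def
        intro!: image_eqI[OF _ translate_edge])
  fix b assume b: "b \<in> carrier G"
  show "translate (a \<otimes> b) x = translate a (translate b x)" if "x \<in> ?V \<union> ?A" for x
    using that a b by (auto elim!: edgeE vertexE simp: translate_def m_assoc)
  show "a = b" if "\<And>v. v \<in> ?V \<Longrightarrow> translate a v = translate b v"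
  proof -
    \<comment> \<open>This one vertex is sent to \<open>(a, \<one>)\<close> and to
      \<open>(b, \<one>)\<close>, which determines the group element.\<close>
    have "(\<one>, \<one>) \<in> vertices" by (simp add: vertices_def)
    from that[OF imageI[OF this]] show ?thesis using a b by (simp add: translate_def)
  qed
next
  show "translate \<one> x = x" if "x \<in> vertex ` vertices \<union> arrow ` edges" for x
    using that by (auto elim!: edgeE vertexE simp: translate_def)
next
  let ?V = "vertex ` vertices" and ?A = "arrow ` edges"
  fix \<sigma> assume bij: "bij_betw \<sigma> ?V ?V"
    and edge: "\<And>v w. v \<in> ?V \<Longrightarrow> w \<in> ?V \<Longrightarrow>
      (\<exists>e\<in>?A. arrow_source e = v \<and> arrow_target e = w) \<longleftrightarrow>
      (\<exists>e\<in>?A. arrow_source e = \<sigma> v \<and> arrow_target e = \<sigma> w)"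
  have bv: "bij_betw vertex vertices ?V" by (auto simp: bij_betw_def intro: inj_onI vertex_inj)
  \<comment> \<open>The permutation is transported from encoded vertices to pairs, where
    \<open>graph_automorphism\<close> applies.\<close>
  define \<tau> where "\<tau> v = inv_into vertices vertex (\<sigma> (vertex v))" for v
  have bt: "bij_betw \<tau> vertices vertices"
    using bij_betw_trans[OF bij_betw_trans[OF bv bij] bij_betw_inv_into[OF bv]] by (simp add: comp_def \<tau>_def[abs_def])
  have vertex_\<tau>: "vertex (\<tau> v) = \<sigma> (vertex v)" if "v \<in> vertices" for v
    unfolding \<tau>_def using bij_betwE[OF bij] that by (auto intro: f_inv_into_f)
  have "(v, w) \<in> edges \<longleftrightarrow> (\<tau> v, \<tau> w) \<in> edges" if "v \<in> vertices" "w \<in> vertices" for v w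
    using edge[OF imageI[OF that(1)] imageI[OF that(2)], folded vertex_\<tau>[OF that(1)] vertex_\<tau>[OF that(2)]]
    unfolding arrow_between .
  from graph_automorphism[OF bt this] obtain a where a: "a \<in> carrier G"
    "\<And>x g. x \<in> carrier G \<Longrightarrow> g \<in> carrier G \<Longrightarrow> \<tau> (x, g) = (a \<otimes> x, g)" by blast
  have "\<sigma> v = translate a v" if "v \<in> ?V" for v
    using that
  proof (rule vertexE)
    fix x g assume v: "v = vertex (x, g)" "x \<in> carrier G" "g \<in> carrier G"
    have "(x, g) \<in> vertices" using v by (simp add: vertices_def)
    from vertex_\<tau>[OF this] show "\<sigma> v = translate a v"
      unfolding v(1) a(2)[OF v(2,3)] by (simp add: translate_def)
  qed
  then show "\<exists>g\<in>carrier G. \<forall>v\<in>?V. \<sigma> v = translate g v" using a(1) by blast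
qed

end

section \<open>Realizing an arbitrary group through a well-order on its underlying type\<close>

theorem corollary1p2:
  fixes k :: "'k ring" and G :: "'g monoid"
  assumes "field k" and "group G"
  shows "\<exists>(C :: ('k, nat \<times> 'g list \<Rightarrow> 'k) coalgebra) (I :: (nat \<times> 'g list) set) \<phi> \<Phi>.
    coalgebra k C \<and>
    \<phi> \<in> hom G (AutoGroup (product_group I (\<lambda>_. affine_group k))) \<and>
    \<Phi> \<in> iso (semidirect_product (product_group I (\<lambda>_. affine_group k)) G \<phi>)
            (coalgebra_AutoGroup k C) \<and>
    (\<lambda>g. grouplike_restriction k C (\<Phi> (\<one>\<^bsub>product_group I (\<lambda>_. affine_group k)\<^esub>, g)))
      \<in> iso G (BijGroup (grouplikes k C)
                \<lparr>carrier := grouplike_restriction k C ` carrier (coalgebra_AutoGroup k C)\<rparr>)"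
proof -
  obtain r :: "'g rel" where "well_order_on UNIV r"
    using well_ordering by metis
  \<comment> \<open>The well-ordering is reflexive; its strict part supplies the relation for
    \<open>wellordered_group\<close>.\<close>
  then have "wf {(x, y). (x, y) \<in> r \<and> x \<noteq> y}" "\<And>x y. x \<noteq> y \<Longrightarrow> (x, y) \<in> r \<or> (y, x) \<in> r"
    by (auto simp: well_order_on_def linear_order_on_def total_on_def elim!: wf_subset)
  then interpret wellordered_group G "\<lambda>x y. (x, y) \<in> r \<and> x \<noteq> y"
    using \<open>group G\<close> by (auto simp: wellordered_group_def wellordered_group_axioms_def)
  interpret quiver_action k "vertex ` vertices" "arrow ` edges" arrow_source arrow_target G translate
    by (rule quiver_action[OF \<open>field k\<close>])
  \<comment> \<open>The index set \<open>I\<close> is the set \<open>arrow\<close> followed by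
    \<open>edges\<close>, that is, the encoded arrows: one affine factor for each.\<close>
  show ?thesis
    using coalgebra_C \<phi>_hom \<Phi>_iso restriction_iso by blast
qed

end
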